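(* Let $E$ be a $k$-coloured graph, $\mathcal C$ an associative complete collection of squares in $E$, $A$ an $(E,\mathcal C)$-automaton, and $\Lambda=\Lambda_{E,\mathcal C}$ the associated $k$-graph. For each $a\in A$ let $g_a$ be the partial isomorphism of $s_A(a)\Lambda$ onto $r_A(a)\Lambda$ given by $g_a(\mu)=\lambda_{a\cdot x}$, where $x\in E^*$ is any path that traverses $\mu$. Let $G_A$ be the subgroupoid of $\operatorname{PIso}(\Lambda)$ generated by $\{g_a:a\in A\}$. Then $(G_A,\Lambda)$ is a self-similar groupoid action.
   Context: Coloured graphs: $\mathbb N=\{0,1,\dots\}$, $e_1,\dots,e_k$ the generators of $\mathbb N^k$. In a directed graph $E=(E^0,E^1,r,s)$, paths are words $x_1\cdots x_l$ of edges with $s(x_i)=r(x_{i+1})$; $E^*$ is the set of finite paths (including vertices), $vE^1=\{e\in E^1:r(e)=v\}$, etc. A $k$-coloured graph is a directed graph with a colour map $c:E^1\to\{c_1,\dots,c_k\}$, extended to $E^*$ with values in the free semigroup; $\omega(c_i)=e_i$ extends to a homomorphism to $\mathbb N^k$. A coloured-graph morphism preserves $r,s,c$. For $p\in\mathbb N^k$, $E_{k,p}$ has vertices $\{q:0\le q\le p\}$ and edges $q+v_i$ (formal symbols, for $q,q+e_i$ both vertices) with $r(q+v_i)=q$, $s(q+v_i)=q+e_i$, colour $c_i$. A square in $E$ is a coloured-graph morphism $\theta:E_{k,e_i+e_j}\to E$, $i\ne j$; it occurs in $\lambda:E_{k,p}\to E$ if for some $q$, $\theta(x)=\lambda(x+q)$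 for all $x\in E_{k,e_i+e_j}$. A complete collection of squares $\mathcal C$ is a set of squares such that for each path $x$ with $c(x)=c_ic_j$, $i\ne j$, there is a unique $\theta\in\mathcal C$ with $x=\theta(v_i)\theta(e_i+v_j)$; then write $\theta(v_i)\theta(e_i+v_j)\sim\theta(v_j)\theta(e_j+v_i)$. $\mathcal C$ is associative if for every path $xyz$ of edges of three distinct colours, the edges determined by $xy\sim x^1y^1$, $x^1z\sim z^1x^2$, $y^1z^1\sim z^2y^2$ and $yz\sim z_1y_1$, $xz_1\sim z_2x_1$, $x_1y_1\sim x_2y_2$ satisfy $x_2=x^2,y_2=y^2,z_2=z^2$. $\lambda:E_{k,p}\to E$ is $\mathcal C$-compatible if every square occurring in it lies in $\mathcal C$. $\Lambda_{E,\mathcal C}$: elements of degree $p$ are the $\mathcal C$-compatible morphisms $\lambda:E_{k,p}\to E$, $r(\lambda)=\lambda(0)$, $s(\lambda)=\lambda(p)$; for $\lambda$ of degree $p$, $\mu$ of degree $q$ with $s(\lambda)=r(\mu)$, $\lambda\mu$ is the unique $\mathcal C$-compatible morphism on $E_{k,p+q}$ restricting to $\lambda$ on $E_{k,p}$ and to $\mu$ on the translate by $p$. This is a $k$-graph (small category with degree functor having unique factorisations). A path $x=x_1\cdots x_l\in E^*$ traverses $\lambda$ of degree $p$ if $\omega(c(x))=p$ and $\lambda(\omega(c(x_1\cdots x_{i-1}))+v_{c(x_i)})=x_i$ for all $i$ (where $v_{c_j}=v_j$; a vertex $x$ traverses $\lambda$ of degree $0$ if $x=\lambda(0)$). Each $x\in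 E^*$ traverses a unique element $\lambda_x$ of $\Lambda_{E,\mathcal C}$. Automata: an $(E,\mathcal C)$-automaton is a finite set $A\supseteq E^0$ with maps $r_A,s_A:A\to E^0$ satisfying $r_A(v)=v=s_A(v)$ for $v\in E^0$, and a map $(a,e)\mapsto(a\cdot e,a|_e)$ from $\{(a,e)\in A\times E^1:s_A(a)=r(e)\}$ to $\{(f,b)\in E^1\times A:s(f)=r_A(b)\}$ such that for all $a\in A$: (A1) $e\mapsto a\cdot e$ is a bijection $s_A(a)E^1\to r_A(a)E^1$; (A2) $c(a\cdot e)=c(e)$; (A3) $s_A(a|_e)=s(e)$; (A4) $r(e)\cdot e=e$ and $r(e)|_e=s(e)$ for $e\in E^1$; (A5) for each square $ef\sim f'e'$ in $\mathcal C$ with $r(e)=s_A(a)$, $(a\cdot e)(a|_e\cdot f)\sim(a\cdot f')(a|_{f'}\cdot e')$; (A6) for each such square, $(a|_e)|_f=(a|_{f'})|_{e'}$. For $x=x_1\cdots x_l\in s_A(a)E^*$ put $a|_x=(\cdots(a|_{x_1})|_{x_2}\cdots)|_{x_l}$ and $a\cdot x=(a\cdot x_1)(a|_{x_1}\cdot x_2)\cdots(a|_{x_1\cdots x_{l-1}}\cdot x_l)$; for a path of length zero, $a\cdot s_A(a)=r_A(a)$. The map $g_a$ is well defined. Self-similar actions: write $v\Lambda=\{\lambda:r(\lambda)=v\}$ and $v\Lambda^p$ for its degree-$p$ part; an edge of $\Lambda$ is an element of degree some $e_i$. A partial isomorphism of $\Lambda$ is a bijection $g:v\Lambda\to w\Lambda$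 ($v,w\in\Lambda^0$) with $g(v\Lambda^p)=w\Lambda^p$ for all $p$ and $g(\lambda e)\in g(\lambda)\Lambda$ for $\lambda\in v\Lambda$ and edges $e\in s(\lambda)\Lambda$; $\operatorname{dom}(g)=v$, $\operatorname{cod}(g)=w$. They form a groupoid $\operatorname{PIso}(\Lambda)$ under composition with unit space $\Lambda^0$ ($v=\mathrm{id}_{v\Lambda}$). A self-similar groupoid action $(G,\Lambda)$ is a groupoid $G$ with unit space $\Lambda^0$ together with an injective (unit-preserving) groupoid homomorphism $G\to\operatorname{PIso}(\Lambda)$, written $g\cdot\mu$, such that for every $g\in G$ and edge $e\in\operatorname{dom}(g)\Lambda$ there is $h\in G$ with $g\cdot(e\lambda)=(g\cdot e)(h\cdot\lambda)$ for all $\lambda\in s(e)\Lambda$. For $G_A$ the homomorphism is the inclusion. *)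

theory Defs
  imports
    "HOL-Analysis.Finite_Cartesian_Product"
    "HOL-Library.FuncSet"
    "HOL.Hull"
    "Graph_Theory.Digraph"
begin

section \<open>Coloured graphs and squares\<close>

(* A k-coloured graph is a digraph E (wf_digraph) with a map c on arcs into a finite type 'k with
   k elements.  head E is the range map r and tail E is the source map s, so that x y is a path if
   tail E x = head E y. Degrees are elements of nat ^ 'k. *)

abbreviation unit_deg :: "'k \<Rightarrow> nat ^ 'k::finite" where
  "unit_deg i \<equiv> axis i 1"

(* E_{k,p}; the formal edge q + v_i is the pair (q, i), and its colour is snd (q, i) = i. *)
definition grid :: "nat ^ 'k::finite \<Rightarrow> (nat ^ 'k, (nat ^ 'k) \<times> 'k) pre_digraph" where
  "grid p =
     \<lparr> verts = {q. q \<le> p},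
       arcs = {(q, i). q \<le> p \<and> q + unit_deg i \<le> p},
       tail = (\<lambda>(q, i). q + unit_deg i),
       head = (\<lambda>(q, i). q) \<rparr>"

definition coloured_graph_morphism ::
  "('a,'b) pre_digraph \<Rightarrow> ('b \<Rightarrow> 'k) \<Rightarrow> ('v,'e) pre_digraph \<Rightarrow> ('e \<Rightarrow> 'k) \<Rightarrow>
   ('a \<Rightarrow> 'v) \<Rightarrow> ('b \<Rightarrow> 'e) \<Rightarrow> bool" where
  "coloured_graph_morphism F cF E cE f0 f1 \<longleftrightarrow>
     (\<forall>q\<in>verts F. f0 q \<in> verts E) \<and>
     (\<forall>x\<in>arcs F. f1 x \<in> arcs E \<and> head E (f1 x) = f0 (head F x) \<and>
        tail E (f1 x) = f0 (tail F x) \<and> cE (f1 x) = cF x)"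

datatype ('v, 'e, 'k::finite) gmor =
  GMor (mdeg: "nat ^ 'k") (vmap: "nat ^ 'k \<Rightarrow> 'v") (emap: "(nat ^ 'k) \<times> 'k \<Rightarrow> 'e")

(* Both component maps are undefined outside E_{k,p}, so that equality in gmor is equality of
   morphisms. *)
definition grid_morphism ::
  "('v,'e) pre_digraph \<Rightarrow> ('e \<Rightarrow> 'k) \<Rightarrow> ('v,'e,'k::finite) gmor \<Rightarrow> bool" where
  "grid_morphism E c l \<longleftrightarrow>
     coloured_graph_morphism (grid (mdeg l)) snd E c (vmap l) (emap l) \<and>
     vmap l \<in> extensional (verts (grid (mdeg l))) \<and>
     emap l \<in> extensional (arcs (grid (mdeg l)))"

(* The morphism n agrees with l on the translate by q of the domain of l. *)
definition restricts_to ::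
  "('v,'e,'k::finite) gmor \<Rightarrow> nat ^ 'k \<Rightarrow> ('v,'e,'k) gmor \<Rightarrow> bool" where
  "restricts_to n q l \<longleftrightarrow>
     q + mdeg l \<le> mdeg n \<and>
     (\<forall>x\<in>verts (grid (mdeg l)). vmap l x = vmap n (x + q)) \<and>
     (\<forall>(x, i)\<in>arcs (grid (mdeg l)). emap l (x, i) = emap n (x + q, i))"

definition is_square ::
  "('v,'e) pre_digraph \<Rightarrow> ('e \<Rightarrow> 'k) \<Rightarrow> ('v,'e,'k::finite) gmor \<Rightarrow> bool" where
  "is_square E c \<theta> \<longleftrightarrow>
     grid_morphism E c \<theta> \<and> (\<exists>i j. i \<noteq> j \<and> mdeg \<theta> = unit_deg i + unit_deg j)"

definition occurs_in :: "('v,'e,'k::finite) gmor \<Rightarrow> ('v,'e,'k) gmor \<Rightarrow> bool" where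
  "occurs_in \<theta> l \<longleftrightarrow> (\<exists>q. restricts_to l q \<theta>)"

definition complete_collection ::
  "('v,'e) pre_digraph \<Rightarrow> ('e \<Rightarrow> 'k) \<Rightarrow> ('v,'e,'k::finite) gmor set \<Rightarrow> bool" where
  "complete_collection E c C \<longleftrightarrow>
     (\<forall>\<theta>\<in>C. is_square E c \<theta>) \<and>
     (\<forall>x\<in>arcs E. \<forall>y\<in>arcs E. tail E x = head E y \<and> c x \<noteq> c y \<longrightarrow>
        (\<exists>!\<theta>. \<theta> \<in> C \<and> mdeg \<theta> = unit_deg (c x) + unit_deg (c y) \<and>
           emap \<theta> (0, c x) = x \<and> emap \<theta> (unit_deg (c x), c y) = y))"

(* square_rel C x y y' x' is  x y ~ y' x'. *)
definition square_rel ::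
  "('v,'e,'k::finite) gmor set \<Rightarrow> 'e \<Rightarrow> 'e \<Rightarrow> 'e \<Rightarrow> 'e \<Rightarrow> bool" where
  "square_rel C x y y' x' \<longleftrightarrow>
     (\<exists>\<theta>\<in>C. \<exists>i j. i \<noteq> j \<and> mdeg \<theta> = unit_deg i + unit_deg j \<and>
        x = emap \<theta> (0, i) \<and> y = emap \<theta> (unit_deg i, j) \<and>
        y' = emap \<theta> (0, j) \<and> x' = emap \<theta> (unit_deg j, i))"

(* The variables xu1, xl1, ... stand for x^1, x_1, ...; each has the colour of the edge it is
   named after, so the square on x y reads x y ~ y^1 x^1, and the two ways of reversing the
   colours of x y z end in z^2 y^2 x^2 and z_2 y_2 x_2. *)
definition associative_collection ::
  "('v,'e) pre_digraph \<Rightarrow> ('e \<Rightarrow> 'k) \<Rightarrow> ('v,'e,'k::finite) gmor set \<Rightarrow> bool" where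
  "associative_collection E c C \<longleftrightarrow>
     (\<forall>x\<in>arcs E. \<forall>y\<in>arcs E. \<forall>z\<in>arcs E.
        tail E x = head E y \<and> tail E y = head E z \<and>
        c x \<noteq> c y \<and> c y \<noteq> c z \<and> c x \<noteq> c z \<longrightarrow>
        (\<forall>xu1 yu1 zu1 xu2 yu2 zu2 xl1 yl1 zl1 xl2 yl2 zl2.
           square_rel C x y yu1 xu1 \<and> square_rel C xu1 z zu1 xu2 \<and> square_rel C yu1 zu1 zu2 yu2 \<and>
           square_rel C y z zl1 yl1 \<and> square_rel C x zl1 zl2 xl1 \<and> square_rel C xl1 yl1 yl2 xl2 \<longrightarrow>
           xl2 = xu2 \<and> yl2 = yu2 \<and> zl2 = zu2))"

definition compatible ::
  "('v,'e) pre_digraph \<Rightarrow> ('e \<Rightarrow> 'k) \<Rightarrow> ('v,'e,'k::finite) gmor set \<Rightarrow> ('v,'e,'k) gmor \<Rightarrow> bool" where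
  "compatible E c C l \<longleftrightarrow>
     grid_morphism E c l \<and> (\<forall>\<theta>. is_square E c \<theta> \<and> occurs_in \<theta> l \<longrightarrow> \<theta> \<in> C)"


section \<open>Categories, groupoids and k-graphs\<close>

(* cmp f g is the composite f g, defined if src f = rng g. *)
record ('o, 'm) cat =
  objs :: "'o set"
  arrs :: "'m set"
  rng :: "'m \<Rightarrow> 'o"
  src :: "'m \<Rightarrow> 'o"
  ident :: "'o \<Rightarrow> 'm"
  cmp :: "'m \<Rightarrow> 'm \<Rightarrow> 'm"

locale category =
  fixes K :: "('o, 'm, 'x) cat_scheme"
  assumes rng_in: "f \<in> arrs K \<Longrightarrow> rng K f \<in> objs K"
    and src_in: "f \<in> arrs K \<Longrightarrow> src K f \<in> objs K"
    and ident_in: "v \<in> objs K \<Longrightarrow> ident K v \<in> arrs K"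
    and rng_ident: "v \<in> objs K \<Longrightarrow> rng K (ident K v) = v"
    and src_ident: "v \<in> objs K \<Longrightarrow> src K (ident K v) = v"
    and cmp_in: "\<lbrakk>f \<in> arrs K; g \<in> arrs K; src K f = rng K g\<rbrakk> \<Longrightarrow> cmp K f g \<in> arrs K"
    and rng_cmp: "\<lbrakk>f \<in> arrs K; g \<in> arrs K; src K f = rng K g\<rbrakk> \<Longrightarrow> rng K (cmp K f g) = rng K f"
    and src_cmp: "\<lbrakk>f \<in> arrs K; g \<in> arrs K; src K f = rng K g\<rbrakk> \<Longrightarrow> src K (cmp K f g) = src K g"
    and ident_cmp: "f \<in> arrs K \<Longrightarrow> cmp K (ident K (rng K f)) f = f"
    and cmp_ident: "f \<in> arrs K \<Longrightarrow> cmp K f (ident K (src K f)) = f"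
    and cmp_assoc: "\<lbrakk>f \<in> arrs K; g \<in> arrs K; h \<in> arrs K; src K f = rng K g; src K g = rng K h\<rbrakk>
        \<Longrightarrow> cmp K (cmp K f g) h = cmp K f (cmp K g h)"

definition is_inverse :: "('o, 'm, 'x) cat_scheme \<Rightarrow> 'm \<Rightarrow> 'm \<Rightarrow> bool" where
  "is_inverse K f g \<longleftrightarrow>
     g \<in> arrs K \<and> rng K g = src K f \<and> src K g = rng K f \<and>
     cmp K f g = ident K (rng K f) \<and> cmp K g f = ident K (src K f)"

locale groupoid = category G for G :: "('o, 'm, 'x) cat_scheme" +
  assumes ex_inverse: "g \<in> arrs G \<Longrightarrow> \<exists>h. is_inverse G g h"

definition subgroupoid :: "('o, 'm, 'x) cat_scheme \<Rightarrow> 'm set \<Rightarrow> bool" where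
  "subgroupoid G H \<longleftrightarrow>
     H \<subseteq> arrs G \<and>
     (\<forall>g\<in>H. \<forall>h\<in>H. src G g = rng G h \<longrightarrow> cmp G g h \<in> H) \<and>
     (\<forall>g\<in>H. \<forall>h. is_inverse G g h \<longrightarrow> h \<in> H)"

record ('o, 'm, 'k::finite) kgraph_data = "('o, 'm) cat" +
  deg :: "'m \<Rightarrow> nat ^ 'k"

locale kgraph = category \<Lambda> for \<Lambda> :: "('o, 'm, 'k::finite) kgraph_data" +
  assumes deg_ident: "v \<in> objs \<Lambda> \<Longrightarrow> deg \<Lambda> (ident \<Lambda> v) = 0"
    and deg_cmp: "\<lbrakk>l \<in> arrs \<Lambda>; m \<in> arrs \<Lambda>; src \<Lambda> l = rng \<Lambda> m\<rbrakk>
        \<Longrightarrow> deg \<Lambda> (cmp \<Lambda> l m) = deg \<Lambda> l + deg \<Lambda> m"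
    and unique_factorisation: "\<lbrakk>l \<in> arrs \<Lambda>; deg \<Lambda> l = p + q\<rbrakk>
        \<Longrightarrow> \<exists>!(m, n). m \<in> arrs \<Lambda> \<and> n \<in> arrs \<Lambda> \<and> src \<Lambda> m = rng \<Lambda> n \<and>
              deg \<Lambda> m = p \<and> deg \<Lambda> n = q \<and> l = cmp \<Lambda> m n"

definition range_at :: "('o, 'm, 'k::finite) kgraph_data \<Rightarrow> 'o \<Rightarrow> 'm set" where
  "range_at \<Lambda> v = {l \<in> arrs \<Lambda>. rng \<Lambda> l = v}"

definition range_deg_at :: "('o, 'm, 'k::finite) kgraph_data \<Rightarrow> 'o \<Rightarrow> nat ^ 'k \<Rightarrow> 'm set" where
  "range_deg_at \<Lambda> v p = {l \<in> range_at \<Lambda> v. deg \<Lambda> l = p}"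

definition edges_at :: "('o, 'm, 'k::finite) kgraph_data \<Rightarrow> 'o \<Rightarrow> 'm set" where
  "edges_at \<Lambda> v = (\<Union>i. range_deg_at \<Lambda> v (unit_deg i))"


section \<open>Partial isomorphisms and self-similar actions\<close>

record ('o, 'm) piso =
  pdom :: 'o
  pcod :: 'o
  pfun :: "'m \<Rightarrow> 'm"

definition is_piso :: "('o, 'm, 'k::finite) kgraph_data \<Rightarrow> ('o, 'm) piso \<Rightarrow> bool" where
  "is_piso \<Lambda> g \<longleftrightarrow>
     pdom g \<in> objs \<Lambda> \<and> pcod g \<in> objs \<Lambda> \<and>
     pfun g \<in> extensional (range_at \<Lambda> (pdom g)) \<and>
     bij_betw (pfun g) (range_at \<Lambda> (pdom g)) (range_at \<Lambda> (pcod g)) \<and>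
     (\<forall>p. pfun g ` range_deg_at \<Lambda> (pdom g) p = range_deg_at \<Lambda> (pcod g) p) \<and>
     (\<forall>l\<in>range_at \<Lambda> (pdom g). \<forall>e\<in>edges_at \<Lambda> (src \<Lambda> l).
        pfun g (cmp \<Lambda> l e) \<in> cmp \<Lambda> (pfun g l) ` range_at \<Lambda> (src \<Lambda> (pfun g l)))"

definition PIso :: "('o, 'm, 'k::finite) kgraph_data \<Rightarrow> ('o, ('o, 'm) piso) cat" where
  "PIso \<Lambda> =
     \<lparr> objs = objs \<Lambda>,
       arrs = {g. is_piso \<Lambda> g},
       rng = pcod,
       src = pdom,
       ident = (\<lambda>v. \<lparr> pdom = v, pcod = v, pfun = (\<lambda>l\<in>range_at \<Lambda> v. l) \<rparr>),
       cmp = (\<lambda>g h. \<lparr> pdom = pdom h, pcod = pcod g,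
                      pfun = compose (range_at \<Lambda> (pdom h)) (pfun g) (pfun h) \<rparr>) \<rparr>"

(* In the last axiom, h and g . e have the domain and source needed for the products on the
   right-hand side to be defined. *)
locale self_similar_action = \<Lambda>: kgraph \<Lambda> + G: groupoid G
  for \<Lambda> :: "('o, 'm, 'k::finite) kgraph_data"
    and G :: "('o, 'g) cat" +
  fixes \<phi> :: "'g \<Rightarrow> ('o, 'm) piso"
  assumes objs_eq: "objs G = objs \<Lambda>"
    and hom_in: "g \<in> arrs G \<Longrightarrow> \<phi> g \<in> arrs (PIso \<Lambda>)"
    and hom_rng: "g \<in> arrs G \<Longrightarrow> rng (PIso \<Lambda>) (\<phi> g) = rng G g"
    and hom_src: "g \<in> arrs G \<Longrightarrow> src (PIso \<Lambda>) (\<phi> g) = src G g"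
    and hom_ident: "v \<in> objs G \<Longrightarrow> \<phi> (ident G v) = ident (PIso \<Lambda>) v"
    and hom_cmp: "\<lbrakk>g \<in> arrs G; h \<in> arrs G; src G g = rng G h\<rbrakk>
        \<Longrightarrow> \<phi> (cmp G g h) = cmp (PIso \<Lambda>) (\<phi> g) (\<phi> h)"
    and hom_inj: "inj_on \<phi> (arrs G)"
    and self_similar: "\<lbrakk>g \<in> arrs G; e \<in> edges_at \<Lambda> (src G g)\<rbrakk>
        \<Longrightarrow> \<exists>h\<in>arrs G. src G h = src \<Lambda> e \<and> rng G h = src \<Lambda> (pfun (\<phi> g) e) \<and>
              (\<forall>l\<in>range_at \<Lambda> (src \<Lambda> e).
                 pfun (\<phi> g) (cmp \<Lambda> e l) = cmp \<Lambda> (pfun (\<phi> g) e) (pfun (\<phi> h) l))"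


section \<open>The k-graph of a collection of squares\<close>

(* The objects are the vertices of E; the morphism of degree 0 at v is ident v. *)
definition Lambda ::
  "('v,'e) pre_digraph \<Rightarrow> ('e \<Rightarrow> 'k) \<Rightarrow> ('v,'e,'k::finite) gmor set \<Rightarrow>
   ('v, ('v,'e,'k) gmor, 'k) kgraph_data" where
  "Lambda E c C =
     \<lparr> objs = verts E,
       arrs = {l. compatible E c C l},
       rng = (\<lambda>l. vmap l 0),
       src = (\<lambda>l. vmap l (mdeg l)),
       ident = (\<lambda>v. GMor 0 (\<lambda>q\<in>verts (grid 0). v) (\<lambda>x. undefined)),
       cmp = (\<lambda>l m. THE n. compatible E c C n \<and> mdeg n = mdeg l + mdeg m \<and>
                restricts_to n 0 l \<and> restricts_to n (mdeg l) m),
       deg = mdeg \<rparr>"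

(* A path is a pair (v, xs) of its range v and its list of edges xs; a vertex v is (v, []). *)
fun is_path :: "('v,'e) pre_digraph \<Rightarrow> 'v \<times> 'e list \<Rightarrow> bool" where
  "is_path E (v, []) \<longleftrightarrow> v \<in> verts E"
| "is_path E (v, x # xs) \<longleftrightarrow> x \<in> arcs E \<and> head E x = v \<and> is_path E (tail E x, xs)"

definition word_deg :: "('e \<Rightarrow> 'k) \<Rightarrow> 'e list \<Rightarrow> nat ^ 'k::finite" where
  "word_deg c xs = (\<Sum>x\<leftarrow>xs. unit_deg (c x))"

definition traverses ::
  "('e \<Rightarrow> 'k) \<Rightarrow> 'v \<times> 'e list \<Rightarrow> ('v,'e,'k::finite) gmor \<Rightarrow> bool" where
  "traverses c x l \<longleftrightarrow>
     (case x of (v, xs) \<Rightarrow>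
        vmap l 0 = v \<and> mdeg l = word_deg c xs \<and>
        (\<forall>i<length xs. emap l (word_deg c (take i xs), c (xs ! i)) = xs ! i))"

definition path_class ::
  "('v,'e) pre_digraph \<Rightarrow> ('e \<Rightarrow> 'k) \<Rightarrow> ('v,'e,'k::finite) gmor set \<Rightarrow> 'v \<times> 'e list \<Rightarrow>
   ('v,'e,'k) gmor" where
  "path_class E c C x = (THE l. l \<in> arrs (Lambda E c C) \<and> traverses c x l)"


section \<open>Automata\<close>

(* States and vertices have the same type, so that the vertex set can be a subset of the state
   set.  act A a e is a . e and sect A a e is a|_e. *)
record ('v, 'e) automaton =
  states :: "'v set"
  arng :: "'v \<Rightarrow> 'v"
  asrc :: "'v \<Rightarrow> 'v"
  act :: "'v \<Rightarrow> 'e \<Rightarrow> 'e"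
  sect :: "'v \<Rightarrow> 'e \<Rightarrow> 'v"

locale EC_automaton =
  fixes E :: "('v,'e) pre_digraph" and c :: "'e \<Rightarrow> 'k::finite"
    and C :: "('v,'e,'k) gmor set" and A :: "('v,'e) automaton"
  assumes finite_states: "finite (states A)"
    and verts_subset: "verts E \<subseteq> states A"
    and arng_in: "a \<in> states A \<Longrightarrow> arng A a \<in> verts E"
    and asrc_in: "a \<in> states A \<Longrightarrow> asrc A a \<in> verts E"
    and arng_vert: "v \<in> verts E \<Longrightarrow> arng A v = v"
    and asrc_vert: "v \<in> verts E \<Longrightarrow> asrc A v = v"
    and act_in: "\<lbrakk>a \<in> states A; e \<in> arcs E; asrc A a = head E e\<rbrakk> \<Longrightarrow> act A a e \<in> arcs E"
    and sect_in: "\<lbrakk>a \<in> states A; e \<in> arcs E; asrc A a = head E e\<rbrakk> \<Longrightarrow> sect A a e \<in> states A"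
    and tail_act: "\<lbrakk>a \<in> states A; e \<in> arcs E; asrc A a = head E e\<rbrakk>
        \<Longrightarrow> tail E (act A a e) = arng A (sect A a e)"
    and A1: "a \<in> states A \<Longrightarrow>
        bij_betw (act A a) {e \<in> arcs E. head E e = asrc A a} {e \<in> arcs E. head E e = arng A a}"
    and A2: "\<lbrakk>a \<in> states A; e \<in> arcs E; asrc A a = head E e\<rbrakk> \<Longrightarrow> c (act A a e) = c e"
    and A3: "\<lbrakk>a \<in> states A; e \<in> arcs E; asrc A a = head E e\<rbrakk> \<Longrightarrow> asrc A (sect A a e) = tail E e"
    and A4: "e \<in> arcs E \<Longrightarrow> act A (head E e) e = e \<and> sect A (head E e) e = tail E e"
    and A5: "\<lbrakk>a \<in> states A; square_rel C e f f' e'; head E e = asrc A a\<rbrakk> \<Longrightarrow>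
        square_rel C (act A a e) (act A (sect A a e) f) (act A a f') (act A (sect A a f') e')"
    and A6: "\<lbrakk>a \<in> states A; square_rel C e f f' e'; head E e = asrc A a\<rbrakk> \<Longrightarrow>
        sect A (sect A a e) f = sect A (sect A a f') e'"

fun act_word :: "('v,'e) automaton \<Rightarrow> 'v \<Rightarrow> 'e list \<Rightarrow> 'e list" where
  "act_word A a [] = []"
| "act_word A a (x # xs) = act A a x # act_word A (sect A a x) xs"

(* a . x for a path x with range asrc A a; in particular a . asrc A a = arng A a. *)
definition act_path :: "('v,'e) automaton \<Rightarrow> 'v \<Rightarrow> 'v \<times> 'e list \<Rightarrow> 'v \<times> 'e list" where
  "act_path A a x = (arng A a, act_word A a (snd x))"

(* The value at m is the unique element obtained as path_class (a . x) from the paths x that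
   traverse m; it is unspecified unless all these paths give the same element. *)
definition state_piso ::
  "('v,'e) pre_digraph \<Rightarrow> ('e \<Rightarrow> 'k) \<Rightarrow> ('v,'e,'k::finite) gmor set \<Rightarrow> ('v,'e) automaton \<Rightarrow>
   'v \<Rightarrow> ('v, ('v,'e,'k) gmor) piso" where
  "state_piso E c C A a =
     \<lparr> pdom = asrc A a,
       pcod = arng A a,
       pfun = (\<lambda>m\<in>range_at (Lambda E c C) (asrc A a).
         THE n. \<exists>x. is_path E x \<and> traverses c x m \<and> n = path_class E c C (act_path A a x)) \<rparr>"

definition automaton_groupoid ::
  "('v,'e) pre_digraph \<Rightarrow> ('e \<Rightarrow> 'k) \<Rightarrow> ('v,'e,'k::finite) gmor set \<Rightarrow> ('v,'e) automaton \<Rightarrow>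
   ('v, ('v, ('v,'e,'k) gmor) piso) cat" where
  "automaton_groupoid E c C A =
     (PIso (Lambda E c C))
       \<lparr> arrs := subgroupoid (PIso (Lambda E c C)) hull (state_piso E c C A ` states A) \<rparr>"

end

theory Submission
  imports Defs
begin

text \<open>
  Moving the first edge of colour \<open>i\<close> of a path to the front, by successive commutations of
  squares, splits the path into an \<open>i\<close>-coloured edge and a remainder.  By associativity,
  the operations for different colours commute up to a square.  Hence the remainder after removing
  a given degree is well defined, the edges so obtained form the unique compatible morphism
  traversed by the path, and composition in \<open>\<Lambda>\<close> is concatenation of paths.

  Axioms (A5) and (A6) say that the automaton commutes with these moves.  So
  \<open>g\<^sub>a\<close> is well defined and bijective, and \<open>a \<cdot> (xy) = (a \<cdot> x)(a|\<^sub>x \<cdot> y)\<close> makes it a partial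
  isomorphism whose restrictions are the \<open>g\<^sub>b\<close> with \<open>b = a|\<^sub>x\<close>.  The elements of the generated
  groupoid that have restrictions in it form a subgroupoid containing the generators, hence are
  all of it.
\<close>

section \<open>Degrees and grids\<close>

(* Otherwise the simplifier turns unit_deg i = axis i 1 into axis i (Suc 0). *)
declare One_nat_def [simp del]

text \<open>A compatible morphism constrains a grid with one dimension per colour, while
  associativity speaks of three edges only, and both the product of \<open>Lambda\<close> and the
  class of a path are hidden behind \<open>THE\<close>. Pulling a single colour forward makes this
  tractable: the edge passes only edges of other colours, every exchange is a forced square, and so
  the move is a partial function. Neither normal forms of paths nor confluence of arbitrary
  exchanges come up; associativity enters only in the commutation of two pulls of distinct colours.

  Two paths are compared in the same way, by pulling the colours of the second out of the first. A
  state preserves this relation and, thanks to (A1), reflects it, which gives well-definedness and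
  injectivity of g_a by similar inductions.

  Two points concern the groupoid. The definition of a partial isomorphism says nothing about
  prefixes under the inverse map; unique factorisation supplies this. A set closed under products
  and inverses may lack units, but by (A4) the states that are vertices act as units, so all units
  are among the generators.\<close>

lemma unit_deg_nth: "unit_deg i $ j = (if j = i then 1 else 0)" for i j :: "'k::finite"
  by (simp add: axis_def)

lemma deg_less_eq_iff: "p \<le> q \<longleftrightarrow> (\<exists>r. q = p + r)" for p q :: "nat ^ 'k::finite"
proof
  assume "p \<le> q"
  then have "q = p + (q - p)"
    by (simp add: vec_eq_iff less_eq_vec_def)
  then show "\<exists>r. q = p + r" ..
qed (auto simp: less_eq_vec_def)

lemma deg_le_add [simp]: "p \<le> p + q" "p \<le> q + p" for p q :: "nat ^ 'k::finite"
  by (auto simp: less_eq_vec_def)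

lemma unit_deg_le_iff: "unit_deg i \<le> p \<longleftrightarrow> p $ i > 0" for p :: "nat ^ 'k::finite"
  by (auto simp: less_eq_vec_def axis_def)

lemma le_zero_deg_iff: "p \<le> 0 \<longleftrightarrow> p = 0" for p :: "nat ^ 'k::finite"
  by (auto simp: less_eq_vec_def vec_eq_iff)

lemma unit_deg_neq_zero [simp]: "p + unit_deg i \<noteq> (0 :: nat ^ 'k::finite)"
  by (auto simp: vec_eq_iff axis_def)

text \<open>A nonzero degree dominates some generator, and splitting it off lowers the sum of the
  coordinates by one.\<close>

lemma deg_induct [case_names zero add_unit]:
  fixes p :: "nat ^ 'k::finite"
  assumes "P 0" and "\<And>p i. P p \<Longrightarrow> P (p + unit_deg i)"
  shows "P p"
proof (induction "\<Sum>i\<in>UNIV. p $ i" arbitrary: p)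
  case 0
  then have "p = 0"
    by (simp add: vec_eq_iff)
  with assms(1) show ?case by simp
next
  case (Suc n)
  then obtain i where "p $ i \<noteq> 0"
    by (metis (no_types, lifting) Zero_neq_Suc sum.neutral)
  then obtain q where q: "p = q + unit_deg i"
    using unit_deg_le_iff[of i p] by (auto simp: deg_less_eq_iff add.commute)
  have "(\<Sum>j\<in>UNIV. unit_deg i $ j) = (1::nat)"
    by (simp add: axis_def)
  then have "n = (\<Sum>j\<in>UNIV. q $ j)"
    using Suc(2) by (simp add: q sum.distrib)
  then show ?case
    using Suc(1) assms(2) q by metis
qed

lemma verts_grid [simp]: "q \<in> verts (grid p) \<longleftrightarrow> q \<le> p"
  by (simp add: grid_def)

lemma arcs_grid [simp]: "(q, i) \<in> arcs (grid p) \<longleftrightarrow> q + unit_deg i \<le> p"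
  by (auto simp: grid_def deg_less_eq_iff add.assoc)

lemma tail_grid [simp]: "tail (grid p) (q, i) = q + unit_deg i"
  and head_grid [simp]: "head (grid p) (q, i) = q"
  by (simp_all add: grid_def)

lemma deg_le_unit_degD:
  fixes q :: "nat ^ 'k::finite"
  assumes "q \<le> unit_deg j"
  shows "q = 0 \<or> q = unit_deg j"
proof -
  have le: "q $ n \<le> (if n = j then 1 else 0)" for n
    using assms[unfolded less_eq_vec_def, rule_format, of n] by (simp add: axis_def split: if_splits)
  then have off: "q $ n = 0" if "n \<noteq> j" for n
    using that le[of n] by simp
  have "q $ j = 0 \<or> q $ j = 1"
    using le[of j] by (auto simp: le_Suc_eq)
  then show ?thesis
  proof
    assume "q $ j = 0"
    then have "q $ n = 0" for n
      using off by (cases "n = j") auto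
    then show ?thesis by (simp add: vec_eq_iff)
  next
    assume "q $ j = 1"
    then have "q $ n = unit_deg j $ n" for n
      using off[of n] by (cases "n = j") (auto simp: axis_def)
    then show ?thesis by (simp only: vec_eq_iff simp_thms)
  qed
qed

text \<open>Only the coordinates i and j leave room for an arc, and an arc of one of these colours
  starts below the other generator. A square is therefore known from four edges, which is how a
  square met in a grid is later recognised as a member of \<open>C\<close>.\<close>

lemma arcs_square_grid:
  fixes i j m :: "'k::finite"
  assumes "q + unit_deg m \<le> unit_deg i + unit_deg j"
  shows "(q, m) \<in> {(0, i), (0, j), (unit_deg i, j), (unit_deg j, i)}"
proof -
  have le: "q $ n + unit_deg m $ n \<le> unit_deg i $ n + unit_deg j $ n" for n
    using assms by (simp add: less_eq_vec_def)
  have "m = i \<or> m = j"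
    using le[of m] by (simp add: axis_def split: if_splits)
  then show ?thesis
  proof
    assume m: "m = i"
    have "q \<le> unit_deg j"
      using le unfolding m less_eq_vec_def by (metis add.commute add_le_cancel_left)
    with m show ?thesis using deg_le_unit_degD[of q] by blast
  next
    assume m: "m = j"
    have "q \<le> unit_deg i"
      using le unfolding m less_eq_vec_def by (metis add_le_cancel_right)
    with m show ?thesis using deg_le_unit_degD[of q] by blast
  qed
qed

text \<open>From any vertex other than the top corner some arc leads upwards, and the top corner is
  reached from below. Degree zero is a genuine exception: its grid is a lone vertex, and edges say
  nothing about it.\<close>

lemma grid_vertex_on_arc:
  fixes p :: "nat ^ 'k::finite"
  assumes "q \<le> p" and "p \<noteq> 0"
  shows "\<exists>x\<in>arcs (grid p). q = head (grid p) x \<or> q = tail (grid p) x"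
proof (cases "q = p")
  case True
  obtain i where "p $ i > 0"
    using assms(2) by (auto simp: vec_eq_iff)
  then obtain r where "p = r + unit_deg i"
    using unit_deg_le_iff[of i p] by (auto simp: deg_less_eq_iff add.commute)
  then show ?thesis
    using True by (intro bexI[of _ "(r, i)"]) auto
next
  case False
  then obtain i where "q $ i < p $ i"
    using assms(1) by (metis less_eq_vec_def order_le_neq_trans vec_eq_iff)
  then have "q + unit_deg i \<le> p"
    using assms(1) by (auto simp: less_eq_vec_def axis_def)
  then show ?thesis
    by (intro bexI[of _ "(q, i)"]) auto
qed

lemma grid_morphismD:
  assumes "grid_morphism E c l" and "q + unit_deg i \<le> mdeg l"
  shows "emap l (q, i) \<in> arcs E" "head E (emap l (q, i)) = vmap l q"
    "tail E (emap l (q, i)) = vmap l (q + unit_deg i)" "c (emap l (q, i)) = i"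
  using assms arcs_grid[of q i "mdeg l"]
  by (fastforce simp: grid_morphism_def coloured_graph_morphism_def)+

lemma grid_morphism_vert: "grid_morphism E c l \<Longrightarrow> q \<le> mdeg l \<Longrightarrow> vmap l q \<in> verts E"
  by (simp add: grid_morphism_def coloured_graph_morphism_def)

lemma grid_morphism_eqI:
  assumes "grid_morphism E c l" "grid_morphism E c m" "mdeg l = mdeg m"
    and "\<And>q. q \<le> mdeg l \<Longrightarrow> vmap l q = vmap m q"
    and "\<And>q i. q + unit_deg i \<le> mdeg l \<Longrightarrow> emap l (q, i) = emap m (q, i)"
  shows "l = m"
proof -
  have "vmap l = vmap m"
    using assms(1-4) by (intro extensionalityI[of _ "verts (grid (mdeg l))"])
      (auto simp: grid_morphism_def)
  moreover have "emap l = emap m"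
    using assms(1-3,5) by (intro extensionalityI[of _ "arcs (grid (mdeg l))"])
      (auto simp: grid_morphism_def)
  ultimately show ?thesis
    using assms(3) by (cases l; cases m) auto
qed

lemma grid_morphism_eqI_edges:
  assumes l: "grid_morphism E c l" and m: "grid_morphism E c m"
    and deg: "mdeg l = mdeg m" "mdeg l \<noteq> 0"
    and edges: "\<And>q i. q + unit_deg i \<le> mdeg l \<Longrightarrow> emap l (q, i) = emap m (q, i)"
  shows "l = m"
proof (rule grid_morphism_eqI[OF l m])
  fix q assume "q \<le> mdeg l"
  then obtain r i where r: "r + unit_deg i \<le> mdeg l" "q = r \<or> q = r + unit_deg i"
    using grid_vertex_on_arc[OF _ deg(2), of q] by auto
  show "vmap l q = vmap m q"
    using r edges[OF r(1)] grid_morphismD[OF l r(1)] grid_morphismD[OF m, of r i] deg(1) by auto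
qed (use deg edges in auto)

lemma word_deg_simps [simp]:
  "word_deg c [] = 0" "word_deg c (x # xs) = unit_deg (c x) + word_deg c xs"
  "word_deg c (xs @ ys) = word_deg c xs + word_deg c ys"
  by (simp_all add: word_deg_def)

lemma word_deg_eq_zero_iff [simp]: "word_deg c xs = 0 \<longleftrightarrow> xs = []"
proof (cases xs)
  case (Cons x ys)
  then show ?thesis
    using unit_deg_neq_zero[of "word_deg c ys" "c x"] by (simp add: add.commute)
qed simp

section \<open>Reordering paths\<close>

locale square_collection = wf_digraph E
  for E :: "('v,'e) pre_digraph" +
  fixes c :: "'e \<Rightarrow> 'k::finite" and C :: "('v,'e,'k) gmor set"
  assumes complete: "complete_collection E c C"
    and associative: "associative_collection E c C"
begin

section \<open>Squares as an exchange relation on paths of two edges\<close>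

lemma squareD:
  assumes "square_rel C x y y' x'"
  shows "x \<in> arcs E" "y \<in> arcs E" "y' \<in> arcs E" "x' \<in> arcs E" "c x' = c x" "c y' = c y" "c x \<noteq> c y"
    "tail E x = head E y" "head E y' = head E x" "tail E y' = head E x'" "tail E x' = tail E y"
proof -
  obtain \<theta> i j where \<theta>: "\<theta> \<in> C" "i \<noteq> j" "mdeg \<theta> = unit_deg i + unit_deg j"
    "x = emap \<theta> (0, i)" "y = emap \<theta> (unit_deg i, j)"
    "y' = emap \<theta> (0, j)" "x' = emap \<theta> (unit_deg j, i)"
    using assms unfolding square_rel_def by blast
  have g: "grid_morphism E c \<theta>"
    using complete \<theta>(1) by (auto simp: complete_collection_def is_square_def)
  have le: "0 + unit_deg i \<le> mdeg \<theta>" "0 + unit_deg j \<le> mdeg \<theta>"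
    "unit_deg i + unit_deg j \<le> mdeg \<theta>" "unit_deg j + unit_deg i \<le> mdeg \<theta>"
    using \<theta>(3) by (simp_all add: add.commute)
  note facts = grid_morphismD[OF g le(1)] grid_morphismD[OF g le(2)]
    grid_morphismD[OF g le(3)] grid_morphismD[OF g le(4)]
  show "x \<in> arcs E" "y \<in> arcs E" "y' \<in> arcs E" "x' \<in> arcs E" "c x' = c x" "c y' = c y"
    "c x \<noteq> c y" "tail E x = head E y" "head E y' = head E x" "tail E y' = head E x'"
    "tail E x' = tail E y"
    using facts \<theta> by (simp_all add: add.commute)
qed

lemma square_sym:
  assumes "square_rel C x y y' x'"
  shows "square_rel C y' x' x y"
proof -
  obtain \<theta> i j where "\<theta> \<in> C" "i \<noteq> j" "mdeg \<theta> = unit_deg i + unit_deg j"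
    "x = emap \<theta> (0, i)" "y = emap \<theta> (unit_deg i, j)"
    "y' = emap \<theta> (0, j)" "x' = emap \<theta> (unit_deg j, i)"
    using assms unfolding square_rel_def by blast
  then show ?thesis
    unfolding square_rel_def
    by (intro bexI[of _ \<theta>] exI[of _ j] exI[of _ i]) (auto simp: add.commute)
qed

lemma square_ex:
  assumes "x \<in> arcs E" "y \<in> arcs E" "tail E x = head E y" "c x \<noteq> c y"
  obtains y' x' where "square_rel C x y y' x'"
proof -
  obtain \<theta> where "\<theta> \<in> C" "mdeg \<theta> = unit_deg (c x) + unit_deg (c y)"
    "emap \<theta> (0, c x) = x" "emap \<theta> (unit_deg (c x), c y) = y"
    using assms complete unfolding complete_collection_def by blast
  then have "square_rel C x y (emap \<theta> (0, c y)) (emap \<theta> (unit_deg (c y), c x))"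
    using assms(4) unfolding square_rel_def
    by (intro bexI[of _ \<theta>] exI[of _ "c x"] exI[of _ "c y"]) auto
  then show thesis by (rule that)
qed

text \<open>The colours i and j are existentially quantified in \<open>square_rel\<close>. Since a
  square preserves colours they must be \<open>c x\<close> and \<open>c y\<close>, the indices under
  which completeness asserts uniqueness.\<close>

lemma square_relE:
  assumes "square_rel C x y y' x'"
  obtains \<theta> where "\<theta> \<in> C" "mdeg \<theta> = unit_deg (c x) + unit_deg (c y)"
    "emap \<theta> (0, c x) = x" "emap \<theta> (unit_deg (c x), c y) = y"
    "emap \<theta> (0, c y) = y'" "emap \<theta> (unit_deg (c y), c x) = x'"
proof -
  obtain \<theta> i j where \<theta>: "\<theta> \<in> C" "i \<noteq> j" "mdeg \<theta> = unit_deg i + unit_deg j"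
    "x = emap \<theta> (0, i)" "y = emap \<theta> (unit_deg i, j)"
    "y' = emap \<theta> (0, j)" "x' = emap \<theta> (unit_deg j, i)"
    using assms unfolding square_rel_def by blast
  have g: "grid_morphism E c \<theta>"
    using complete \<theta>(1) by (auto simp: complete_collection_def is_square_def)
  have "0 + unit_deg i \<le> mdeg \<theta>" "unit_deg i + unit_deg j \<le> mdeg \<theta>"
    using \<theta>(3) by simp_all
  then have "c x = i" "c y = j"
    using grid_morphismD(4)[OF g] \<theta>(4,5) by auto
  then show thesis
    using that[OF \<theta>(1)] \<theta>(3-7) by simp
qed

lemma square_unique:
  assumes "square_rel C x y y' x'" "square_rel C x y y'' x''"
  shows "y'' = y'" "x'' = x'"
proof -
  have ex1: "\<exists>!\<theta>. \<theta> \<in> C \<and> mdeg \<theta> = unit_deg (c x) + unit_deg (c y) \<and>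
           emap \<theta> (0, c x) = x \<and> emap \<theta> (unit_deg (c x), c y) = y"
    using complete squareD[OF assms(1)] unfolding complete_collection_def by blast
  obtain \<theta> where \<theta>: "\<theta> \<in> C" "mdeg \<theta> = unit_deg (c x) + unit_deg (c y)"
    "emap \<theta> (0, c x) = x" "emap \<theta> (unit_deg (c x), c y) = y"
    "emap \<theta> (0, c y) = y'" "emap \<theta> (unit_deg (c y), c x) = x'"
    by (rule square_relE[OF assms(1)])
  obtain \<eta> where \<eta>: "\<eta> \<in> C" "mdeg \<eta> = unit_deg (c x) + unit_deg (c y)"
    "emap \<eta> (0, c x) = x" "emap \<eta> (unit_deg (c x), c y) = y"
    "emap \<eta> (0, c y) = y''" "emap \<eta> (unit_deg (c y), c x) = x''"
    by (rule square_relE[OF assms(2)])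
  have "\<eta> = \<theta>" using ex1 \<theta>(1-4) \<eta>(1-4) by blast
  then show "y'' = y'" "x'' = x'"
    using \<theta>(5,6) \<eta>(5,6) by auto
qed

lemma square_assoc:
  assumes "square_rel C x y y1 x1" "square_rel C x1 z z1 x2" "square_rel C y1 z1 z2 y2"
    and "square_rel C y z z1' y1'" "square_rel C x z1' z2' x1'" "square_rel C x1' y1' y2' x2'"
  shows "x2' = x2" "y2' = y2" "z2' = z2"
proof -
  have "x \<in> arcs E" "y \<in> arcs E" "z \<in> arcs E" "tail E x = head E y" "tail E y = head E z"
    "c x \<noteq> c y" "c y \<noteq> c z" "c x \<noteq> c z"
    using squareD[OF assms(1)] squareD[OF assms(2)] squareD[OF assms(4)] by auto
  then have "x2' = x2 \<and> y2' = y2 \<and> z2' = z2"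
    using associative assms unfolding associative_collection_def by blast
  then show "x2' = x2" "y2' = y2" "z2' = z2" by auto
qed

(* "pull i x e y": moving the first edge of colour i of the path x to the front gives e y. *)
inductive pull :: "'k \<Rightarrow> 'v \<times> 'e list \<Rightarrow> 'e \<Rightarrow> 'v \<times> 'e list \<Rightarrow> bool" where
  here: "pull (c x) (head E x, x # xs) x (tail E x, xs)"
| there: "c x \<noteq> i \<Longrightarrow> pull i (tail E x, xs) e (u, ys) \<Longrightarrow> square_rel C x e e' x' \<Longrightarrow>
    pull i (head E x, x # xs) e' (tail E e', x' # ys)"

lemma pull_props:
  assumes "pull i x e y" "is_path E x"
  shows "is_path E y" "e \<in> arcs E" "head E e = fst x" "tail E e = fst y" "c e = i"
    "word_deg c (snd x) = unit_deg i + word_deg c (snd y)"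
proof -
  have "is_path E y \<and> e \<in> arcs E \<and> head E e = fst x \<and> tail E e = fst y \<and> c e = i \<and>
    word_deg c (snd x) = unit_deg i + word_deg c (snd y)"
    using assms
  proof (induction rule: pull.induct)
    case (there x i xs e u ys e' x')
    then show ?case
      using squareD[OF there(3)] by (auto simp: ac_simps)
  qed auto
  then show "is_path E y" "e \<in> arcs E" "head E e = fst x" "tail E e = fst y" "c e = i"
    "word_deg c (snd x) = unit_deg i + word_deg c (snd y)" by auto
qed

text \<open>The colour of the first edge decides which rule applies, and completeness leaves one
  choice for the square crossed.\<close>

lemma pull_unique:
  assumes "pull i x e y" "pull i x e' y'"
  shows "e' = e" "y' = y"
proof -
  have "e' = e \<and> y' = y"
    using assms
  proof (induction arbitrary: e' y' rule: pull.induct)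
    case (here x xs)
    then show ?case by (cases rule: pull.cases) auto
  next
    case (there x i xs e u ys f x')
    from there(5) show ?case
    proof (cases rule: pull.cases)
      case here
      then show ?thesis using there(1) by simp
    next
      case (there e1 u1 ys1 x1)
      with \<open>square_rel C x e f x'\<close> "there.IH" show ?thesis
        by (metis prod.inject square_unique)
    qed
  qed
  then show "e' = e" "y' = y" by auto
qed

lemma pull_ex:
  assumes "is_path E (v, xs)" "unit_deg i \<le> word_deg c xs"
  obtains e y where "pull i (v, xs) e y"
proof -
  have "\<exists>e y. pull i (v, xs) e y"
    using assms
  proof (induction xs arbitrary: v)
    case Nil
      then show ?case using unit_deg_le_iff[of i "0 :: nat ^ 'k"] by simp
  next
    case (Cons x xs)
    then have x: "x \<in> arcs E" "head E x = v" "is_path E (tail E x, xs)" by auto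
    show ?case
    proof (cases "c x = i")
      case True
      then show ?thesis using x here[of x xs] by auto
    next
      case False
      then have "unit_deg i \<le> word_deg c xs"
        using Cons(3) by (simp add: unit_deg_le_iff unit_deg_nth)
      then obtain e u ys where e: "pull i (tail E x, xs) e (u, ys)"
        using Cons(1) x by fastforce
      then have "e \<in> arcs E" "tail E x = head E e" "c x \<noteq> c e"
        using pull_props[OF e x(3)] False by auto
      then obtain e' x' where "square_rel C x e e' x'"
        using square_ex x(1) by blast
      then show ?thesis
        using there[OF False e] x by blast
    qed
  qed
  then show thesis using that by blast
qed

(* If the path begins with an edge of a third colour, the claim for the first three edges is the
   associativity of the collection of squares. *)
lemma pull_commute:
  assumes "pull i x e y" "pull j y f z" "i \<noteq> j" "is_path E x"
  shows "\<exists>f' e' y'. pull j x f' y' \<and> pull i y' e' z \<and> square_rel C e f f' e'"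
  using assms
proof (induction arbitrary: f z rule: pull.induct)
  case (here x xs)
  then have xs: "is_path E (tail E x, xs)" "x \<in> arcs E" by auto
  obtain u zs where z: "z = (u, zs)" by fastforce
  have f: "f \<in> arcs E" "head E f = tail E x" "c f = j" "tail E f = fst z"
    using pull_props[OF here(1) xs(1)] by auto
  \<comment> \<open>The edge pulled first is \<open>x\<close> itself. Pulling j from the whole path
    instead moves \<open>f\<close> across \<open>x\<close>, and the square crossed is the one
    claimed.\<close>
  then obtain f' x' where sq: "square_rel C x f f' x'"
    using square_ex xs(2) here(2) by metis
  note sqD = squareD[OF sq]
  have "pull j (head E x, x # xs) f' (tail E f', x' # zs)"
    using here z sq by (intro there) auto
  moreover have "pull (c x) (tail E f', x' # zs) x' z"
    using pull.here[of x' zs] sqD f z by simp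
  ultimately show ?case using sq by blast
next
  case (there x i xs e u ys e' x')
  note sqD = squareD[OF there(3)]
  have xs: "is_path E (tail E x, xs)" "x \<in> arcs E" using there(7) by auto
  note e = pull_props[OF there(2) xs(1)]
  from there(5) show ?case
  proof (cases rule: pull.cases)
    case here
    \<comment> \<open>Here \<open>x'\<close>, and with it \<open>x\<close>, has colour j, so pulling
      j takes \<open>x\<close> itself; the required square is the one that carried \<open>e\<close>
      past \<open>x\<close>, read backwards.\<close>
    have "pull j (head E x, x # xs) x (tail E x, xs)"
      using pull.here[of x xs] here sqD by simp
    moreover have "z = (u, ys)"
      using here sqD e by simp
    ultimately show ?thesis
      using there(2) square_sym[OF there(3)] here by blast
  next
    case (there f0 u' zs0 x2)
    have pj: "pull j (u, ys) f0 (u', zs0)"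
      using there e sqD by simp
    obtain f1 e1 w where IH: "pull j (tail E x, xs) f1 w" "pull i w e1 (u', zs0)" "square_rel C e f0 f1 e1"
      using "there.IH"[OF pj there.prems(2) xs(1)] by blast
    note w = pull_props[OF IH(1) xs(1)]
    have "c x \<noteq> c f1"
      using w there sqD by auto
    then obtain f2 x1 where sq2: "square_rel C x f1 f2 x1"
      using square_ex[of x f1] w xs by auto
    note sq2D = squareD[OF sq2]
    note IHD = squareD[OF IH(3)]
    have "c x1 \<noteq> c e1"
      using sq2D IHD \<open>c x \<noteq> i\<close> e by simp
    then obtain e3 x3 where sq3: "square_rel C x1 e1 e3 x3"
      using square_ex[of x1 e1] IHD sq2D by metis
    obtain wv ws where w': "w = (wv, ws)" by fastforce
    have c1: "pull j (head E x, x # xs) f2 (tail E f2, x1 # ws)"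
      using sq2D w w' IH(1) sq2 \<open>c x \<noteq> c f1\<close> by (intro pull.there) auto
    have "pull i (head E x1, x1 # ws) e3 (tail E e3, x3 # zs0)"
      using IH(2) sq3 w' w sq2D \<open>c x \<noteq> i\<close> by (intro pull.there) auto
    then have c2: "pull i (tail E f2, x1 # ws) e3 (tail E e3, x3 # zs0)"
      using sq2D by simp
    have "square_rel C x' f0 f x2" using there by simp
    obtain f4 e4 where sq4: "square_rel C e' f f4 e4"
      using square_ex[of e' f] squareD[OF \<open>square_rel C x' f0 f x2\<close>] sqD \<open>i \<noteq> j\<close> e there IHD w by metis
    \<comment> \<open>Associativity on the path \<open>x\<close>, \<open>e\<close>,
      \<open>f0\<close>: one reversal begins by moving \<open>e\<close> past \<open>x\<close>, the
      other by exchanging \<open>e\<close> with \<open>f0\<close> behind \<open>x\<close>. The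
      square \<open>sq4\<close> closes the first reversal.\<close>
    have "x3 = x2" "e3 = e4" "f2 = f4"
      using square_assoc[OF \<open>square_rel C x e e' x'\<close> \<open>square_rel C x' f0 f x2\<close> sq4 IH(3) sq2 sq3] by auto
    moreover have "tail E f = tail E e3"
      using squareD[OF sq4] \<open>e3 = e4\<close> squareD[OF \<open>square_rel C x' f0 f x2\<close>] squareD[OF sq3] \<open>x3 = x2\<close> by simp
    ultimately show ?thesis
      using c1 c2 sq4 there by auto
  qed
qed

section \<open>The morphism traversed by a path\<close>


(* "remainder q x y": removing the degree-q initial segment of the path x leaves y. *)
inductive remainder :: "nat ^ 'k \<Rightarrow> 'v \<times> 'e list \<Rightarrow> 'v \<times> 'e list \<Rightarrow> bool" where
  zero: "remainder 0 x x"
| step: "pull i x e y \<Longrightarrow> remainder q y z \<Longrightarrow> remainder (q + unit_deg i) x z"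

lemma remainder_props:
  assumes "remainder q x y" "is_path E x"
  shows "is_path E y" "word_deg c (snd x) = q + word_deg c (snd y)"
proof -
  have "is_path E y \<and> word_deg c (snd x) = q + word_deg c (snd y)"
    using assms
  proof (induction rule: remainder.induct)
    case (step i x e y q z)
    then show ?case
      using pull_props[OF step(1,4)] by (simp add: ac_simps)
  qed simp
  then show "is_path E y" "word_deg c (snd x) = q + word_deg c (snd y)" by auto
qed

text \<open>The given derivation may begin with a colour j other than i. Then an edge of colour i is
  still available after that pull, the induction hypothesis removes it there, and
  \<open>pull_commute\<close> exchanges the two pulls. Hence any available colour may be removed
  first, which is what makes remainders unique.\<close>

lemma remainder_pull:
  assumes "remainder (q + unit_deg i) x z" "pull i x e y" "is_path E x"
  shows "remainder q y z"
  using assms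
proof (induction "q + unit_deg i" x z arbitrary: q e y rule: remainder.induct)
  case (zero x)
  then show ?case by (metis unit_deg_neq_zero)
next
  case (step j x f y' q' z)
  show ?case
  proof (cases "j = i")
    case True
    then have "q' = q" "y' = y"
      using step(4) pull_unique[OF step(1), of e y] step(5) by auto
    then show ?thesis using step(2) by simp
  next
    case False
    have "q' $ i > 0"
      using arg_cong[OF step(4), of "\<lambda>p. p $ i"] False by (simp add: axis_def)
    then obtain r where r: "q' = r + unit_deg i"
      using unit_deg_le_iff[of i q'] by (metis add.commute deg_less_eq_iff)
    then have "q + unit_deg i = (r + unit_deg j) + unit_deg i"
      using step(4) by (simp add: ac_simps)
    then have q: "q = r + unit_deg j"
      by (rule add_right_imp_eq)
    note y' = pull_props[OF step(1,6)]
    have "unit_deg i \<le> word_deg c (snd y')"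
      using remainder_props(2)[OF step(2) y'(1)] r by (simp add: unit_deg_le_iff)
    then obtain e' u where u: "pull i y' e' u"
      using pull_ex[of "fst y'" "snd y'" i] y'(1) by auto
    have "remainder r u z"
      using step(3)[OF r u y'(1)] .
    moreover obtain e1 y1 f1 where "pull i x e1 y1" "pull j y1 f1 u"
      using pull_commute[OF step(1) u False step(6)] by blast
    ultimately show ?thesis
      using q pull_unique(2)[OF step(5)] remainder.step by metis
  qed
qed

lemma remainder_unique:
  assumes "remainder q x y" "remainder q x z" "is_path E x"
  shows "y = z"
  using assms
proof (induction rule: remainder.induct)
  case (zero x)
  from zero(1) show ?case
  proof (cases rule: remainder.cases)
    case (step i e y q)
    then show ?thesis by (metis unit_deg_neq_zero)
  qed simp
next
  case (step i x e y q w)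
  then show ?case
    using remainder_pull pull_props(1) by blast
qed

text \<open>The rule \<open>step\<close> adds a pull at the front, whereas moving along one more
  edge of the grid, from a point already reached, adds a pull at the far end.\<close>

lemma remainder_snoc:
  assumes "remainder q x y" "pull i y e z"
  shows "remainder (q + unit_deg i) x z"
  using assms
proof (induction rule: remainder.induct)
  case (zero x)
  then show ?case using remainder.step[OF zero remainder.zero] by simp
next
  case (step j x f y q w)
  then show ?case
    using remainder.step[OF step(1) step(3)] by (simp add: ac_simps)
qed

lemma remainder_ex:
  assumes "is_path E x" "q \<le> word_deg c (snd x)"
  obtains y where "remainder q x y"
proof -
  have "\<exists>y. remainder q x y"
    using assms(2)
  proof (induction q rule: deg_induct)
    case zero
    then show ?case using remainder.zero by blast
  next
    case (add_unit q i)
    have "q \<le> word_deg c (snd x)"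
      using add_unit(2) deg_le_add(1) order_trans by blast
    then obtain y where y: "remainder q x y"
      using add_unit(1) by blast
    note yp = remainder_props[OF y assms(1)]
    obtain r where "q + word_deg c (snd y) = q + unit_deg i + r"
      using add_unit(2) yp(2) by (auto simp: deg_less_eq_iff)
    then have "word_deg c (snd y) = unit_deg i + r"
      by (simp add: add.assoc)
    then have "unit_deg i \<le> word_deg c (snd y)"
      by simp
    then obtain e z where "pull i y e z"
      using pull_ex[of "fst y" "snd y" i] yp(1) by auto
    then show ?case
      using remainder_snoc[OF y] by blast
  qed
  then show thesis using that by blast
qed

text \<open>The two ways around the grid square at q are two orders of pulling i and j from the
  remainder at q; \<open>pull_commute\<close> says that together they bound a square of
  \<open>C\<close>.\<close>

lemma square_of_remainder:
  assumes x: "is_path E x" and q: "remainder q x y" and "i \<noteq> j"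
    and le: "q + unit_deg i + unit_deg j \<le> word_deg c (snd x)"
  obtains e f f' e' u v z where "pull i y e u" "pull j u f z" "pull j y f' v" "pull i v e' z"
    "square_rel C e f f' e'"
proof -
  note y = remainder_props[OF q x]
  obtain r where "q + word_deg c (snd y) = q + unit_deg i + unit_deg j + r"
    using le y(2) by (auto simp: deg_less_eq_iff)
  then have r: "word_deg c (snd y) = unit_deg i + (unit_deg j + r)"
    by (simp add: add.assoc)
  then obtain e u where e: "pull i y e u"
    using pull_ex[of "fst y" "snd y" i] y(1) by auto
  note u = pull_props[OF e y(1)]
  have "word_deg c (snd u) = unit_deg j + r"
    using u(6) r by simp
  then obtain f z where f: "pull j u f z"
    using pull_ex[of "fst u" "snd u" j] u(1) by auto
  show thesis
    using pull_commute[OF e f \<open>i \<noteq> j\<close> y(1)] that e f by blast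
qed

text \<open>An explicit candidate for the morphism traversed by the path: a point q of the grid
  stands for what is left of the path beyond q. Both descriptions by \<open>THE\<close> are
  justified by uniqueness of remainders and pulls.\<close>

definition path_mor :: "'v \<times> 'e list \<Rightarrow> ('v,'e,'k) gmor" where
  "path_mor x = GMor (word_deg c (snd x))
     (\<lambda>q\<in>verts (grid (word_deg c (snd x))). fst (THE y. remainder q x y))
     (\<lambda>(q, i)\<in>arcs (grid (word_deg c (snd x))). THE e. \<exists>y z. remainder q x y \<and> pull i y e z)"

lemma mdeg_path_mor [simp]: "mdeg (path_mor x) = word_deg c (snd x)"
  by (simp add: path_mor_def)

lemma vmap_path_mor:
  assumes "is_path E x" "remainder q x y"
  shows "vmap (path_mor x) q = fst y"
proof -
  have "(THE y. remainder q x y) = y"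
    using remainder_unique assms by blast
  moreover have "q \<le> word_deg c (snd x)"
    using remainder_props(2)[OF assms(2,1)] by simp
  ultimately show ?thesis by (simp add: path_mor_def)
qed

lemma emap_path_mor:
  assumes "is_path E x" "remainder q x y" "pull i y e z"
  shows "emap (path_mor x) (q, i) = e"
proof -
  have "(THE e. \<exists>y z. remainder q x y \<and> pull i y e z) = e"
    using remainder_unique[OF assms(2) _ assms(1)] pull_unique(1)[OF assms(3)] assms
    by (intro the_equality) blast+
  moreover have "(q, i) \<in> arcs (grid (word_deg c (snd x)))"
    using remainder_props(2)[OF remainder_snoc[OF assms(2,3)] assms(1)] by simp
  ultimately show ?thesis by (simp add: path_mor_def)
qed

lemma grid_morphism_path_mor:
  assumes x: "is_path E x"
  shows "grid_morphism E c (path_mor x)"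
proof -
  have vert: "vmap (path_mor x) q \<in> verts E" if q: "q \<le> word_deg c (snd x)" for q
  proof -
    obtain y where y: "remainder q x y"
      using remainder_ex[OF x q] .
    then have "is_path E y" using remainder_props x by blast
    then have "fst y \<in> verts E" by (cases y; cases "snd y") auto
    then show ?thesis using vmap_path_mor[OF x y] by simp
  qed
  have arc: "emap (path_mor x) (q, i) \<in> arcs E \<and> c (emap (path_mor x) (q, i)) = i \<and>
      head E (emap (path_mor x) (q, i)) = vmap (path_mor x) q \<and>
      tail E (emap (path_mor x) (q, i)) = vmap (path_mor x) (q + unit_deg i)"
    if q: "q + unit_deg i \<le> word_deg c (snd x)" for q i
  proof -
    have "q \<le> word_deg c (snd x)"
      using q deg_le_add(1) order_trans by blast
    then obtain y where y: "remainder q x y"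
      using remainder_ex[OF x] by blast
    note yp = remainder_props[OF y x]
    \<comment> \<open>Cancelling q shows that the remainder at q still contains an edge of colour
      i.\<close>
    obtain r where "q + word_deg c (snd y) = q + unit_deg i + r"
      using q yp(2) by (auto simp: deg_less_eq_iff)
    then have "word_deg c (snd y) = unit_deg i + r"
      by (simp add: add.assoc)
    then obtain e z where e: "pull i y e z"
      using pull_ex[of "fst y" "snd y" i] yp(1) by auto
    show ?thesis
      using emap_path_mor[OF x y e] vmap_path_mor[OF x y] vmap_path_mor[OF x remainder_snoc[OF y e]]
        pull_props[OF e yp(1)] by simp
  qed
  show ?thesis
    unfolding grid_morphism_def coloured_graph_morphism_def
    using vert arc by (auto simp: path_mor_def)
qed

text \<open>A version of \<open>traverses\<close> with a free starting point q. Dropping the first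
  edge moves the starting point and keeps the morphism, so inductions on paths can go
  through.\<close>

definition traverses_from :: "('v,'e,'k) gmor \<Rightarrow> nat ^ 'k \<Rightarrow> 'v \<times> 'e list \<Rightarrow> bool" where
  "traverses_from l q x \<longleftrightarrow> vmap l q = fst x \<and> mdeg l = q + word_deg c (snd x) \<and>
     (\<forall>i<length (snd x). emap l (q + word_deg c (take i (snd x)), c (snd x ! i)) = snd x ! i)"

lemma traverses_iff: "traverses c x l \<longleftrightarrow> traverses_from l 0 x"
  by (cases x) (simp add: traverses_def traverses_from_def)

lemma traverses_from_Nil: "traverses_from l q (v, []) \<longleftrightarrow> vmap l q = v \<and> mdeg l = q"
  by (simp add: traverses_from_def)

text \<open>The vertex at which the rest of the path starts is automatically right: a graph morphism
  preserves sources, so \<open>tail E x\<close> is the image of the next grid point.\<close>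

lemma traverses_from_Cons:
  assumes "grid_morphism E c l"
  shows "traverses_from l q (v, x # xs) \<longleftrightarrow> vmap l q = v \<and> q + unit_deg (c x) \<le> mdeg l \<and>
    emap l (q, c x) = x \<and> traverses_from l (q + unit_deg (c x)) (tail E x, xs)"
proof -
  have "tail E x = vmap l (q + unit_deg (c x))"
    if "emap l (q, c x) = x" "mdeg l = q + unit_deg (c x) + word_deg c xs"
    using grid_morphismD(3)[OF assms, of q "c x"] that by simp
  moreover have "q + unit_deg (c x) \<le> q + (unit_deg (c x) + r)" for r
    by (metis add.assoc deg_le_add(1))
  ultimately show ?thesis
    by (auto simp: traverses_from_def All_less_Suc2 add.assoc)
qed

text \<open>The first edge of a path is the first of its colour, so pulling that colour merely drops
  it. Along its own edges, the remainders of a path are thus its literal suffixes.\<close>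

lemma traverses_from_path_mor:
  assumes "is_path E x" "remainder q x (v, ys)"
  shows "traverses_from (path_mor x) q (v, ys)"
  using assms(2)
proof (induction ys arbitrary: q v)
  case Nil
  then show ?case
    using vmap_path_mor[OF assms(1) Nil] remainder_props(2)[OF Nil assms(1)]
    by (simp add: traverses_from_Nil)
next
  case (Cons y ys)
  then have "is_path E (v, y # ys)"
    using remainder_props(1) assms(1) by blast
  then have p: "pull (c y) (v, y # ys) y (tail E y, ys)"
    using pull.here[of y ys] by auto
  show ?case
    using vmap_path_mor[OF assms(1) Cons(2)] emap_path_mor[OF assms(1) Cons(2) p]
      Cons(1)[OF remainder_snoc[OF Cons(2) p]] remainder_props(2)[OF Cons(2) assms(1)]
    by (simp add: traverses_from_Cons[OF grid_morphism_path_mor[OF assms(1)]] flip: add.assoc)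
qed

lemma traverses_path_mor: "is_path E x \<Longrightarrow> traverses_from (path_mor x) 0 x"
  using traverses_from_path_mor[of x 0 "fst x" "snd x"] remainder.zero[of x] by simp

section \<open>Restrictions of morphisms to translated boxes\<close>

definition segment :: "('v,'e,'k) gmor \<Rightarrow> nat ^ 'k \<Rightarrow> nat ^ 'k \<Rightarrow> ('v,'e,'k) gmor" where
  "segment l q r = GMor r (\<lambda>x\<in>verts (grid r). vmap l (x + q))
     (\<lambda>(x, i)\<in>arcs (grid r). emap l (x + q, i))"

lemma mdeg_segment [simp]: "mdeg (segment l q r) = r"
  and vmap_segment: "x \<le> r \<Longrightarrow> vmap (segment l q r) x = vmap l (x + q)"
  and emap_segment: "x + unit_deg i \<le> r \<Longrightarrow> emap (segment l q r) (x, i) = emap l (x + q, i)"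
  by (simp_all add: segment_def)

lemma deg_add_le_add:
  fixes p q r x :: "nat ^ 'k"
  assumes "x \<le> r" "q + r \<le> p"
  shows "x + q \<le> p"
proof -
  have "x $ i + q $ i \<le> p $ i" for i
    using assms[unfolded less_eq_vec_def, rule_format, of i] by simp
  then show ?thesis by (simp add: less_eq_vec_def)
qed

lemma grid_morphism_segment:
  assumes l: "grid_morphism E c l" and le: "q + r \<le> mdeg l"
  shows "grid_morphism E c (segment l q r)"
proof -
  have arc_le: "x + q + unit_deg i \<le> mdeg l" if "x + unit_deg i \<le> r" for x i
    using deg_add_le_add[OF that le] by (simp add: ac_simps)
  then have arc: "emap l (x + q, i) \<in> arcs E \<and> c (emap l (x + q, i)) = i \<and>
      head E (emap l (x + q, i)) = vmap l (x + q) \<and>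
      tail E (emap l (x + q, i)) = vmap l (x + unit_deg i + q)" if "x + unit_deg i \<le> r" for x i
    using grid_morphismD[OF l arc_le[OF that]] by (simp add: ac_simps)
  have "x \<le> r" if "x + unit_deg i \<le> r" for x i
    using that deg_le_add(1) order_trans by blast
  then show ?thesis
    using arc grid_morphism_vert[OF l deg_add_le_add[OF _ le]]
    unfolding grid_morphism_def coloured_graph_morphism_def
    by (auto simp: vmap_segment emap_segment) (auto simp: segment_def)
qed

lemma restricts_to_segment: "q + r \<le> mdeg l \<Longrightarrow> restricts_to l q (segment l q r)"
  by (auto simp: restricts_to_def vmap_segment emap_segment)

text \<open>Turns the relation used in the definition of the product into an equation, so that the
  factors of a product can be computed from it.\<close>

lemma restricts_to_iff:
  assumes "grid_morphism E c n" "grid_morphism E c l"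
  shows "restricts_to n q l \<longleftrightarrow> q + mdeg l \<le> mdeg n \<and> l = segment n q (mdeg l)"
proof
  assume r: "restricts_to n q l"
  then have le: "q + mdeg l \<le> mdeg n" by (simp add: restricts_to_def)
  have "l = segment n q (mdeg l)"
    using r by (intro grid_morphism_eqI[OF assms(2) grid_morphism_segment[OF assms(1) le]])
      (auto simp: restricts_to_def vmap_segment emap_segment)
  with le show "q + mdeg l \<le> mdeg n \<and> l = segment n q (mdeg l)" ..
next
  assume "q + mdeg l \<le> mdeg n \<and> l = segment n q (mdeg l)"
  then show "restricts_to n q l"
    using restricts_to_segment[of q "mdeg l" n] by metis
qed

lemma compatible_segment:
  assumes l: "compatible E c C l" and le: "q + r \<le> mdeg l"
  shows "compatible E c C (segment l q r)"
proof -
  have "occurs_in \<theta> l" if \<theta>: "occurs_in \<theta> (segment l q r)" for \<theta>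
  proof -
    obtain t where t: "restricts_to (segment l q r) t \<theta>"
      using \<theta> by (auto simp: occurs_in_def)
    then have tr: "t + mdeg \<theta> \<le> r"
      by (simp add: restricts_to_def)
    have "t + mdeg \<theta> + q \<le> mdeg l"
      using deg_add_le_add[OF tr le] .
    moreover have "x + t \<le> r" if "x \<le> mdeg \<theta>" for x
      using deg_add_le_add[OF that tr] .
    moreover have "x + t + unit_deg i \<le> r" if "x + unit_deg i \<le> mdeg \<theta>" for x i
      using deg_add_le_add[OF that tr] by (simp add: ac_simps)
    ultimately have "restricts_to l (t + q) \<theta>"
      using t by (auto simp: restricts_to_def vmap_segment emap_segment ac_simps)
    then show ?thesis by (auto simp: occurs_in_def)
  qed
  then show ?thesis
    using l grid_morphism_segment[OF _ le] by (auto simp: compatible_def)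
qed


lemma square_in_compatible:
  assumes l: "compatible E c C l" and le: "q + unit_deg i + unit_deg j \<le> mdeg l" and ij: "i \<noteq> j"
  shows "square_rel C (emap l (q, i)) (emap l (q + unit_deg i, j))
    (emap l (q, j)) (emap l (q + unit_deg j, i))"
proof -
  let ?\<theta> = "segment l q (unit_deg i + unit_deg j)"
  have le': "q + (unit_deg i + unit_deg j) \<le> mdeg l"
    using le by (simp add: add.assoc)
  have "is_square E c ?\<theta>"
    unfolding is_square_def using grid_morphism_segment[OF _ le'] l ij
    by (intro conjI exI[of _ i] exI[of _ j]) (auto simp: compatible_def)
  moreover have "occurs_in ?\<theta> l"
    using restricts_to_segment[OF le'] by (auto simp: occurs_in_def)
  ultimately have "?\<theta> \<in> C"
    using l by (simp add: compatible_def)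
  moreover have "emap ?\<theta> (0, i) = emap l (q, i)"
    "emap ?\<theta> (unit_deg i, j) = emap l (q + unit_deg i, j)"
    "emap ?\<theta> (0, j) = emap l (q, j)" "emap ?\<theta> (unit_deg j, i) = emap l (q + unit_deg j, i)"
    by (simp_all add: emap_segment add.commute)
  ultimately show ?thesis
    unfolding square_rel_def using ij
    by (intro bexI[of _ ?\<theta>] exI[of _ i] exI[of _ j]) simp_all
qed

text \<open>A square occurring at q has the same four edges as the member of \<open>C\<close> given
  by \<open>square_of_remainder\<close>, and a morphism of nonzero degree is determined by its
  edges.\<close>

lemma compatible_path_mor:
  assumes x: "is_path E x"
  shows "compatible E c C (path_mor x)"
  unfolding compatible_def
proof (intro conjI allI impI)
  show g: "grid_morphism E c (path_mor x)"
    using grid_morphism_path_mor[OF x] .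
  fix \<theta> assume \<theta>: "is_square E c \<theta> \<and> occurs_in \<theta> (path_mor x)"
  obtain i j where ij: "i \<noteq> j" "mdeg \<theta> = unit_deg i + unit_deg j"
    using \<theta> by (auto simp: is_square_def)
  obtain q where q: "restricts_to (path_mor x) q \<theta>"
    using \<theta> by (auto simp: occurs_in_def)
  have le: "q + unit_deg i + unit_deg j \<le> word_deg c (snd x)"
    using q ij by (simp add: restricts_to_def add.assoc)
  then have "q \<le> word_deg c (snd x)"
    using deg_le_add(1) order_trans by (metis add.assoc)
  then obtain y where y: "remainder q x y"
    using remainder_ex[OF x] by blast
  obtain e f f' e' u v z where sq: "pull i y e u" "pull j u f z" "pull j y f' v" "pull i v e' z"
    "square_rel C e f f' e'"
    using square_of_remainder[OF x y ij(1) le] .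
  have edges: "emap (path_mor x) (q, i) = e" "emap (path_mor x) (q + unit_deg i, j) = f"
    "emap (path_mor x) (q, j) = f'" "emap (path_mor x) (q + unit_deg j, i) = e'"
    using emap_path_mor[OF x y] emap_path_mor[OF x remainder_snoc[OF y]] sq by auto
  have yp: "is_path E y" using remainder_props(1)[OF y x] .
  have col: "c e = i" "c f = j"
    using pull_props[OF sq(1) yp] pull_props[OF sq(2)] by auto
  obtain \<eta> where \<eta>: "\<eta> \<in> C" "mdeg \<eta> = unit_deg i + unit_deg j"
    "emap \<eta> (0, i) = e" "emap \<eta> (unit_deg i, j) = f"
    "emap \<eta> (0, j) = f'" "emap \<eta> (unit_deg j, i) = e'"
    using square_relE[OF sq(5)] unfolding col by blast
  have \<eta>g: "grid_morphism E c \<eta>"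
    using complete \<eta>(1) by (auto simp: complete_collection_def is_square_def)
  have \<theta>g: "grid_morphism E c \<theta>"
    using \<theta> by (simp add: is_square_def)
  have "\<theta> = \<eta>"
  proof (rule grid_morphism_eqI_edges[OF \<theta>g \<eta>g])
    show "mdeg \<theta> = mdeg \<eta>" using ij \<eta> by simp
    show "mdeg \<theta> \<noteq> 0" using ij unit_deg_neq_zero by metis
    fix r m assume r: "r + unit_deg m \<le> mdeg \<theta>"
    then have "emap \<theta> (r, m) = emap (path_mor x) (r + q, m)"
      using q by (auto simp: restricts_to_def)
    moreover have "(r, m) \<in> {(0, i), (0, j), (unit_deg i, j), (unit_deg j, i)}"
      using arcs_square_grid[of r m i j] r ij(2) by simp
    ultimately show "emap \<theta> (r, m) = emap \<eta> (r, m)"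
      using edges \<eta> by (auto simp: add.commute)
  qed
  with \<eta>(1) show "\<theta> \<in> C" by simp
qed


text \<open>In a compatible morphism the grid square at the current point lies in \<open>C\<close>;
  by uniqueness it is the square crossed by the pull. Each exchange thus stays inside the grid, and
  the edge that arrives at the front is the grid edge at q.\<close>

lemma traverses_from_pull:
  assumes l: "compatible E c C l" and "pull i x e y" "traverses_from l q x"
  shows "e = emap l (q, i)" "q + unit_deg i \<le> mdeg l" "traverses_from l (q + unit_deg i) y"
proof -
  have g: "grid_morphism E c l"
    using l by (simp add: compatible_def)
  have "e = emap l (q, i) \<and> q + unit_deg i \<le> mdeg l \<and> traverses_from l (q + unit_deg i) y"
    using assms(2,3)
  proof (induction arbitrary: q rule: pull.induct)
    case (here x xs)
    then show ?case by (simp add: traverses_from_Cons[OF g])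
  next
    case (there x i xs e u ys e' x')
    have x: "q + unit_deg (c x) \<le> mdeg l" "emap l (q, c x) = x"
      "traverses_from l (q + unit_deg (c x)) (tail E x, xs)"
      using there(5) by (simp_all add: traverses_from_Cons[OF g])
    have IH: "e = emap l (q + unit_deg (c x), i)" "q + unit_deg (c x) + unit_deg i \<le> mdeg l"
      "traverses_from l (q + unit_deg (c x) + unit_deg i) (u, ys)"
      using there(4)[OF x(3)] by auto
    have "square_rel C x e (emap l (q, i)) (emap l (q + unit_deg i, c x))"
      using square_in_compatible[OF l IH(2) there(1)] x(2) IH(1) by simp
    from square_unique[OF this there(3)]
    have e': "e' = emap l (q, i)" and x': "x' = emap l (q + unit_deg i, c x)"
      by auto
    have le: "q + unit_deg i + unit_deg (c x) \<le> mdeg l"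
      using IH(2) by (simp add: ac_simps)
    then have le': "q + unit_deg i \<le> mdeg l"
      using deg_le_add(1) order_trans by blast
    have "traverses_from l (q + unit_deg i + unit_deg (c x)) (u, ys)"
      using IH(3) by (simp add: ac_simps)
    moreover from this have "tail E x' = u"
      using grid_morphismD(3)[OF g le] x' by (simp add: traverses_from_def)
    moreover have "tail E e' = vmap l (q + unit_deg i)" "c x' = c x"
      using grid_morphismD[OF g le'] grid_morphismD[OF g le] e' x' by auto
    ultimately show ?case
      using le le' e' x' by (simp add: traverses_from_Cons[OF g])
  qed
  then show "e = emap l (q, i)" "q + unit_deg i \<le> mdeg l" "traverses_from l (q + unit_deg i) y"
    by auto
qed

lemma traverses_from_remainder:
  assumes "compatible E c C l" "remainder q x y" "traverses_from l r x"
  shows "traverses_from l (r + q) y"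
  using assms(2,3)
proof (induction arbitrary: r rule: remainder.induct)
  case (step i x e y q z)
  then show ?case
    using step(3)[OF traverses_from_pull(3)[OF assms(1) step(1,4)]] by (simp add: ac_simps)
qed simp

text \<open>Every grid point is reached by a remainder of x and every grid edge by a pull from one,
  so both maps of l can be read off from x.\<close>

lemma path_mor_unique:
  assumes l: "compatible E c C l" and x: "is_path E x" and t: "traverses_from l 0 x"
  shows "l = path_mor x"
proof (rule grid_morphism_eqI)
  show "grid_morphism E c l" using l by (simp add: compatible_def)
  show "grid_morphism E c (path_mor x)" using grid_morphism_path_mor[OF x] .
  show deg: "mdeg l = mdeg (path_mor x)" using t by (simp add: traverses_from_def)
  fix q assume q: "q \<le> mdeg l"
  obtain y where y: "remainder q x y"
    using remainder_ex[OF x] q deg by auto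
  then show "vmap l q = vmap (path_mor x) q"
    using traverses_from_remainder[OF l y t] vmap_path_mor[OF x y] by (simp add: traverses_from_def)
next
  fix q i assume le: "q + unit_deg i \<le> mdeg l"
  have deg: "mdeg l = word_deg c (snd x)" using t by (simp add: traverses_from_def)
  have "q \<le> mdeg l"
    using le deg_le_add(1) order_trans by blast
  then obtain y where y: "remainder q x y"
    using remainder_ex[OF x] deg by auto
  note yp = remainder_props[OF y x]
  obtain r where "q + word_deg c (snd y) = q + unit_deg i + r"
    using le yp(2) deg by (auto simp: deg_less_eq_iff)
  then have "word_deg c (snd y) = unit_deg i + r"
    by (simp add: add.assoc)
  then obtain e z where e: "pull i y e z"
    using pull_ex[of "fst y" "snd y" i] yp(1) by auto
  then show "emap l (q, i) = emap (path_mor x) (q, i)"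
    using traverses_from_pull(1)[OF l e] traverses_from_remainder[OF l y t] emap_path_mor[OF x y e]
    by simp
qed

text \<open>Any monotone walk from q to the far corner serves; its edges are the grid edges met on
  the way.\<close>

lemma traverses_from_ex:
  assumes g: "grid_morphism E c l" and "q + r = mdeg l"
  shows "\<exists>x. is_path E x \<and> traverses_from l q x"
  using assms(2)
proof (induction r arbitrary: q rule: deg_induct)
  case zero
  then show ?case
    using grid_morphism_vert[OF g, of q]
    by (intro exI[of _ "(vmap l q, [])"]) (simp add: traverses_from_Nil)
next
  case (add_unit r i)
  then have eq: "(q + unit_deg i) + r = mdeg l" by (simp add: ac_simps)
  then have le: "q + unit_deg i \<le> mdeg l" by (metis deg_le_add(1))
  obtain u xs where x: "is_path E (u, xs)" "traverses_from l (q + unit_deg i) (u, xs)"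
    using add_unit(1)[OF eq] by auto
  have "u = vmap l (q + unit_deg i)"
    using x(2) by (simp add: traverses_from_def)
  then show ?case
    using grid_morphismD[OF g le] le x
    by (intro exI[of _ "(vmap l q, emap l (q, i) # xs)"]) (simp add: traverses_from_Cons[OF g])
qed

lemma path_mor_cases:
  assumes "compatible E c C l"
  obtains v xs where "is_path E (v, xs)" "l = path_mor (v, xs)"
proof -
  obtain x where "is_path E x" "traverses_from l 0 x"
    using traverses_from_ex[of l 0 "mdeg l"] assms by (auto simp: compatible_def)
  then show thesis
    using that path_mor_unique[OF assms] by (cases x) blast
qed

lemma traverses_iff_path_mor:
  assumes "is_path E x" "compatible E c C l"
  shows "traverses c x l \<longleftrightarrow> l = path_mor x"
  using assms path_mor_unique traverses_path_mor traverses_iff by blast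

section \<open>The k-graph of a collection of squares\<close>

text \<open>The vertex argument is there for the empty list of edges, which does not determine a
  source.\<close>

primrec path_end :: "'v \<Rightarrow> 'e list \<Rightarrow> 'v" where
  "path_end v [] = v"
| "path_end v (x # xs) = path_end (tail E x) xs"

lemma is_path_vert: "is_path E (v, xs) \<Longrightarrow> v \<in> verts E"
  by (cases xs) auto

lemma is_path_append: "is_path E (v, xs @ ys) \<longleftrightarrow> is_path E (v, xs) \<and> is_path E (path_end v xs, ys)"
  by (induction xs arbitrary: v) (auto dest: is_path_vert)

lemma traverses_from_end:
  assumes "grid_morphism E c l" "traverses_from l q (v, xs)"
  shows "vmap l (mdeg l) = path_end v xs"
  using assms(2)
  by (induction xs arbitrary: q v) (auto simp: traverses_from_Nil traverses_from_Cons[OF assms(1)])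

lemma traverses_from_segment:
  assumes le: "q + word_deg c xs \<le> mdeg l"
  shows "traverses_from (segment l q (word_deg c xs)) 0 (v, xs) \<longleftrightarrow> vmap l q = v \<and>
    (\<forall>i<length xs. emap l (q + word_deg c (take i xs), c (xs ! i)) = xs ! i)"
proof -
  have "word_deg c (take i xs) + unit_deg (c (xs ! i)) \<le> word_deg c xs" if "i < length xs" for i
  proof -
    have "word_deg c xs = word_deg c (take (Suc i) xs @ drop (Suc i) xs)" by simp
    also have "\<dots> = word_deg c (take i xs) + unit_deg (c (xs ! i)) + word_deg c (drop (Suc i) xs)"
      using that by (simp add: take_Suc_conv_app_nth add.assoc del: append_take_drop_id)
    finally show ?thesis by simp
  qed
  then show ?thesis
    by (auto simp: traverses_from_def vmap_segment emap_segment add.commute less_eq_vec_def)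
qed

text \<open>Traversal is a condition on one edge at a time, so it splits where the two words meet.
  The second half starts at the right vertex because the first segment ends at the grid point where
  the first path ends.\<close>

lemma traverses_append:
  assumes g: "grid_morphism E c n" and deg: "mdeg n = word_deg c xs + word_deg c ys"
  shows "traverses_from n 0 (v, xs @ ys) \<longleftrightarrow>
    traverses_from (segment n 0 (word_deg c xs)) 0 (v, xs) \<and>
    traverses_from (segment n (word_deg c xs) (word_deg c ys)) 0 (path_end v xs, ys)"
proof -
  have split: "(\<forall>i<length xs + length ys. P i) \<longleftrightarrow>
      (\<forall>i<length xs. P i) \<and> (\<forall>i<length ys. P (length xs + i))" for P :: "nat \<Rightarrow> bool"
  proof (intro iffI allI conjI impI)
    fix i assume "(\<forall>i<length xs. P i) \<and> (\<forall>i<length ys. P (length xs + i))" "i < length xs + length ys"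
    then show "P i"
      by (cases "i < length xs") (auto dest: spec[of _ "i - length xs"])
  qed auto
  have le: "0 + word_deg c xs \<le> mdeg n" "word_deg c xs + word_deg c ys \<le> mdeg n"
    using deg by auto
  have g1: "grid_morphism E c (segment n 0 (word_deg c xs))"
    using grid_morphism_segment[OF g le(1)] .
  have "vmap n (word_deg c xs) = path_end v xs"
    if "traverses_from (segment n 0 (word_deg c xs)) 0 (v, xs)"
    using traverses_from_end[OF g1 that] by (simp add: vmap_segment)
  then show ?thesis
    unfolding traverses_from_segment[OF le(1)] traverses_from_segment[OF le(2)]
    by (auto simp: traverses_from_def deg split nth_append)
qed

lemma Lambda_simps [simp]:
  "objs (Lambda E c C) = verts E" "arrs (Lambda E c C) = {l. compatible E c C l}"
  "rng (Lambda E c C) l = vmap l 0" "src (Lambda E c C) l = vmap l (mdeg l)"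
  "deg (Lambda E c C) = mdeg"
  by (simp_all add: Lambda_def)

lemma vmap_path_mor_ends:
  assumes "is_path E (v, xs)"
  shows "vmap (path_mor (v, xs)) 0 = v" "vmap (path_mor (v, xs)) (word_deg c xs) = path_end v xs"
  using traverses_path_mor[OF assms] traverses_from_end[OF grid_morphism_path_mor[OF assms] traverses_path_mor[OF assms]]
  by (auto simp: traverses_from_def)

text \<open>Existence and uniqueness behind the \<open>THE\<close> in \<open>cmp\<close> come
  together. With paths chosen for l and m, a compatible n has the two prescribed restrictions
  exactly if it traverses the concatenated path, and exactly one compatible n does.\<close>

lemma cmp_eq_iff:
  assumes l: "compatible E c C l" and m: "compatible E c C m" and lm: "vmap l (mdeg l) = vmap m 0"
  shows "cmp (Lambda E c C) l m = n \<longleftrightarrow> compatible E c C n \<and> mdeg n = mdeg l + mdeg m \<and>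
    segment n 0 (mdeg l) = l \<and> segment n (mdeg l) (mdeg m) = m"
proof -
  obtain v xs where xs: "is_path E (v, xs)" "l = path_mor (v, xs)"
    using path_mor_cases[OF l] .
  obtain u ys where ys: "is_path E (u, ys)" "m = path_mor (u, ys)"
    using path_mor_cases[OF m] .
  have u: "u = path_end v xs"
    using lm vmap_path_mor_ends[OF xs(1)] vmap_path_mor_ends[OF ys(1)] xs(2) ys(2) by simp
  have p: "is_path E (v, xs @ ys)"
    using xs ys u by (simp add: is_path_append)
  \<comment> \<open>The condition inside the \<open>THE\<close>, with restrictions written as
    segments.\<close>
  define R where "R n \<longleftrightarrow> compatible E c C n \<and> mdeg n = mdeg l + mdeg m \<and>
    segment n 0 (mdeg l) = l \<and> segment n (mdeg l) (mdeg m) = m" for n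
  have R_iff: "R n \<longleftrightarrow> n = path_mor (v, xs @ ys)" for n
  proof
    assume n: "R n"
    have "grid_morphism E c n" "mdeg n = word_deg c xs + word_deg c ys"
      using n xs ys by (auto simp: R_def compatible_def)
    note app = traverses_append[OF this]
    have "traverses_from n 0 (v, xs @ ys)"
      unfolding app using n traverses_path_mor[OF xs(1)] traverses_path_mor[OF ys(1)]
      by (simp add: R_def xs ys u)
    then show "n = path_mor (v, xs @ ys)"
      using path_mor_unique[OF _ p] n by (simp add: R_def)
  next
    assume n: "n = path_mor (v, xs @ ys)"
    have nc: "compatible E c C n" and deg: "mdeg n = word_deg c xs + word_deg c ys"
      using compatible_path_mor[OF p] n by auto
    then have "grid_morphism E c n" by (simp add: compatible_def)
    note app = traverses_append[OF this deg]
    have "traverses_from (segment n 0 (word_deg c xs)) 0 (v, xs)"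
      "traverses_from (segment n (word_deg c xs) (word_deg c ys)) 0 (u, ys)"
      using app traverses_path_mor[OF p] n u by auto
    then have "segment n 0 (word_deg c xs) = l" "segment n (word_deg c xs) (word_deg c ys) = m"
      using path_mor_unique[OF compatible_segment[OF nc] xs(1)]
        path_mor_unique[OF compatible_segment[OF nc] ys(1)] deg xs(2) ys(2) by auto
    then show "R n"
      using nc deg xs(2) ys(2) by (simp add: R_def)
  qed
  have "compatible E c C n \<and> mdeg n = mdeg l + mdeg m \<and> restricts_to n 0 l \<and>
      restricts_to n (mdeg l) m \<longleftrightarrow> R n" for n
    using l m by (auto simp: R_def restricts_to_iff compatible_def)
  then have "cmp (Lambda E c C) l m = (THE n. R n)"
    by (simp add: Lambda_def)
  also have "\<dots> = path_mor (v, xs @ ys)"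
    by (simp add: R_iff)
  finally show ?thesis
    using R_iff[of n] unfolding R_def by metis
qed

lemma cmp_path_mor:
  assumes "is_path E (v, xs @ ys)"
  shows "cmp (Lambda E c C) (path_mor (v, xs)) (path_mor (path_end v xs, ys)) = path_mor (v, xs @ ys)"
proof -
  have p: "is_path E (v, xs)" "is_path E (path_end v xs, ys)"
    using assms by (simp_all add: is_path_append)
  have nc: "compatible E c C (path_mor (v, xs @ ys))" (is "compatible E c C ?n")
    using compatible_path_mor[OF assms] .
  then have "grid_morphism E c ?n" by (simp add: compatible_def)
  note app = traverses_append[OF this, of xs ys v]
  have "segment ?n 0 (word_deg c xs) = path_mor (v, xs)"
    "segment ?n (word_deg c xs) (word_deg c ys) = path_mor (path_end v xs, ys)"
    using app traverses_path_mor[OF assms] path_mor_unique[OF compatible_segment[OF nc] p(1)]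
        path_mor_unique[OF compatible_segment[OF nc] p(2)] by auto
  then show ?thesis
    using nc vmap_path_mor_ends[OF p(1)] vmap_path_mor_ends[OF p(2)]
    by (subst cmp_eq_iff) (auto simp: compatible_path_mor p)
qed

text \<open>The grid of degree zero has one vertex and no arcs, so only the image of that vertex has
  to be compared.\<close>

lemma ident_eq_path_mor:
  assumes "v \<in> verts E"
  shows "ident (Lambda E c C) v = path_mor (v, [])"
proof -
  let ?l = "ident (Lambda E c C) v"
  have "grid_morphism E c ?l"
    using assms by (auto simp: Lambda_def grid_morphism_def coloured_graph_morphism_def le_zero_deg_iff
      extensional_def)
  moreover have "grid_morphism E c (path_mor (v, []))"
    using assms by (intro grid_morphism_path_mor) simp
  moreover have "vmap ?l 0 = v" "mdeg ?l = 0"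
    by (simp_all add: Lambda_def)
  ultimately show ?thesis
    using vmap_path_mor_ends(1)[of v "[]"] assms
    by (intro grid_morphism_eqI[of E c]) (auto simp: le_zero_deg_iff)
qed

lemma arr_cases:
  assumes "l \<in> arrs (Lambda E c C)"
  obtains v xs where "is_path E (v, xs)" "l = path_mor (v, xs)" "vmap l 0 = v"
    "vmap l (mdeg l) = path_end v xs"
  using assms path_mor_cases[of l] vmap_path_mor_ends by (metis Lambda_simps(2) mdeg_path_mor mem_Collect_eq snd_conv)

text \<open>With arrows represented by paths, the category laws are those of concatenation of lists.
  For unique factorisation \<open>cmp_eq_iff\<close> is read from right to left: the factors of l of
  degrees p and q can only be its two segments.\<close>

lemma kgraph_Lambda: "kgraph (Lambda E c C)"
proof
  fix l assume l: "l \<in> arrs (Lambda E c C)"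
  obtain v xs where xs: "is_path E (v, xs)" "l = path_mor (v, xs)" "vmap l 0 = v"
    "vmap l (mdeg l) = path_end v xs"
    using arr_cases[OF l] .
  have e: "path_end v xs \<in> verts E"
    using xs(1) is_path_append[of v xs "[]"] by (auto dest: is_path_vert)
  show "rng (Lambda E c C) l \<in> objs (Lambda E c C)" "src (Lambda E c C) l \<in> objs (Lambda E c C)"
    using xs e by (auto dest: is_path_vert)
  show "cmp (Lambda E c C) (ident (Lambda E c C) (rng (Lambda E c C) l)) l = l"
    using cmp_path_mor[of v "[]" xs] xs is_path_vert[OF xs(1)] by (simp add: ident_eq_path_mor)
  show "cmp (Lambda E c C) l (ident (Lambda E c C) (src (Lambda E c C) l)) = l"
    using cmp_path_mor[of v xs "[]"] xs e by (simp add: ident_eq_path_mor)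
next
  fix v assume "v \<in> objs (Lambda E c C)"
  then have v: "is_path E (v, [])" by simp
  show "ident (Lambda E c C) v \<in> arrs (Lambda E c C)" "rng (Lambda E c C) (ident (Lambda E c C) v) = v"
    "src (Lambda E c C) (ident (Lambda E c C) v) = v" "deg (Lambda E c C) (ident (Lambda E c C) v) = 0"
    using v vmap_path_mor_ends[OF v] compatible_path_mor[OF v] by (auto simp: ident_eq_path_mor)
next
  fix l m assume lm: "l \<in> arrs (Lambda E c C)" "m \<in> arrs (Lambda E c C)"
    "src (Lambda E c C) l = rng (Lambda E c C) m"
  obtain v xs where xs: "is_path E (v, xs)" "l = path_mor (v, xs)" "vmap l 0 = v"
    "vmap l (mdeg l) = path_end v xs"
    using arr_cases[OF lm(1)] .
  obtain u ys where ys: "is_path E (u, ys)" "m = path_mor (u, ys)" "vmap m 0 = u"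
    "vmap m (mdeg m) = path_end u ys"
    using arr_cases[OF lm(2)] .
  have u: "u = path_end v xs" using lm xs ys by simp
  have p: "is_path E (v, xs @ ys)" using xs ys u by (simp add: is_path_append)
  have [simp]: "path_end v (xs @ ys) = path_end u ys"
    unfolding u by (induction xs arbitrary: v) auto
  have lm': "cmp (Lambda E c C) l m = path_mor (v, xs @ ys)"
    using cmp_path_mor[OF p] xs ys u by simp
  show "cmp (Lambda E c C) l m \<in> arrs (Lambda E c C)"
    "rng (Lambda E c C) (cmp (Lambda E c C) l m) = rng (Lambda E c C) l"
    "src (Lambda E c C) (cmp (Lambda E c C) l m) = src (Lambda E c C) m"
    "deg (Lambda E c C) (cmp (Lambda E c C) l m) = deg (Lambda E c C) l + deg (Lambda E c C) m"
    using compatible_path_mor[OF p] vmap_path_mor_ends[OF p] lm' xs ys by auto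
  fix n assume n: "n \<in> arrs (Lambda E c C)" "src (Lambda E c C) m = rng (Lambda E c C) n"
  obtain w zs where zs: "is_path E (w, zs)" "n = path_mor (w, zs)" "vmap n 0 = w"
    "vmap n (mdeg n) = path_end w zs"
    using arr_cases[OF n(1)] .
  have w: "w = path_end u ys" using n ys zs by simp
  have "is_path E (v, xs @ ys @ zs)" "is_path E (u, ys @ zs)"
    using p zs(1) ys(1) w u xs(1) by (auto simp: is_path_append)
  then show "cmp (Lambda E c C) (cmp (Lambda E c C) l m) n =
      cmp (Lambda E c C) l (cmp (Lambda E c C) m n)"
    using cmp_path_mor[of v "xs @ ys" zs] cmp_path_mor[of u ys zs] cmp_path_mor[of v xs "ys @ zs"]
      lm' xs(2) ys(2) zs(2) w u by simp
next
  fix l p q assume l: "l \<in> arrs (Lambda E c C)" "deg (Lambda E c C) l = p + q"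
  then have lc: "compatible E c C l" and le: "0 + p \<le> mdeg l" "p + q \<le> mdeg l" and dl: "mdeg l = p + q"
    by auto
  have cmp: "cmp (Lambda E c C) m n = l \<longleftrightarrow> segment l 0 p = m \<and> segment l p q = n"
    if "compatible E c C m" "compatible E c C n" "vmap m p = vmap n 0" "mdeg m = p" "mdeg n = q" for m n
    using cmp_eq_iff[of m n l] that lc dl by simp
  show "\<exists>!(m, n). m \<in> arrs (Lambda E c C) \<and> n \<in> arrs (Lambda E c C) \<and>
      src (Lambda E c C) m = rng (Lambda E c C) n \<and> deg (Lambda E c C) m = p \<and>
      deg (Lambda E c C) n = q \<and> l = cmp (Lambda E c C) m n"
  proof (rule ex1I[of _ "(segment l 0 p, segment l p q)"])
    have "vmap (segment l 0 p) p = vmap (segment l p q) 0"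
      by (simp add: vmap_segment less_eq_vec_def)
    then show "case (segment l 0 p, segment l p q) of (m, n) \<Rightarrow> m \<in> arrs (Lambda E c C) \<and>
      n \<in> arrs (Lambda E c C) \<and> src (Lambda E c C) m = rng (Lambda E c C) n \<and>
      deg (Lambda E c C) m = p \<and> deg (Lambda E c C) n = q \<and> l = cmp (Lambda E c C) m n"
      using compatible_segment[OF lc le(1)] compatible_segment[OF lc le(2)]
        cmp[of "segment l 0 p" "segment l p q"] by simp
    fix mn
    assume mn: "case mn of (m, n) \<Rightarrow> m \<in> arrs (Lambda E c C) \<and> n \<in> arrs (Lambda E c C) \<and>
      src (Lambda E c C) m = rng (Lambda E c C) n \<and> deg (Lambda E c C) m = p \<and>
      deg (Lambda E c C) n = q \<and> l = cmp (Lambda E c C) m n"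
    obtain m n where mn': "mn = (m, n)" by fastforce
    have "segment l 0 p = m \<and> segment l p q = n"
      using mn unfolding mn' by (intro iffD1[OF cmp]) auto
    then show "mn = (segment l 0 p, segment l p q)"
      using mn' by simp
  qed
qed

section \<open>Paths traversing the same morphism\<close>


text \<open>A directed comparison in place of the equivalence relation generated by squares: the
  second path dictates the order in which colours are pulled out of the first. The vertex u in the
  rule \<open>Cons\<close> is always \<open>fst y\<close>.\<close>

inductive reorders :: "'v \<times> 'e list \<Rightarrow> 'v \<times> 'e list \<Rightarrow> bool" where
  Nil: "reorders (v, []) (v, [])"
| Cons: "pull (c e) x e y \<Longrightarrow> reorders y (u, es) \<Longrightarrow> reorders x (fst x, e # es)"

lemma reorders_fst: "reorders x z \<Longrightarrow> fst z = fst x"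
  by (induction rule: reorders.induct) auto

lemma traverses_from_reorders:
  assumes l: "compatible E c C l" and "reorders x z" "traverses_from l q x"
  shows "traverses_from l q z"
  using assms(2,3)
proof (induction arbitrary: q rule: reorders.induct)
  case (Cons e x y u es)
  have g: "grid_morphism E c l" using l by (simp add: compatible_def)
  note p = traverses_from_pull[OF l Cons(1,4)]
  have z: "traverses_from l (q + unit_deg (c e)) (u, es)"
    using Cons(3)[OF p(3)] .
  have "tail E e = u"
    using grid_morphismD(3)[OF g p(2)] p(1) z by (simp add: traverses_from_def)
  then show ?case
    using z p(1,2) Cons(4) by (simp add: traverses_from_Cons[OF g]) (simp add: traverses_from_def)
qed

text \<open>The next edge of the second path is the grid edge of its colour at q. The edge of that
  colour pulled from x is the same grid edge, and both remaining paths traverse l from the next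
  point.\<close>

lemma reorders_if_traverses_from:
  assumes l: "compatible E c C l" and "is_path E x" "traverses_from l q x" "traverses_from l q (v, zs)"
  shows "reorders x (v, zs)"
  using assms(2-)
proof (induction zs arbitrary: q v x)
  case Nil
  then have "x = (v, [])"
    by (cases x) (simp add: traverses_from_def)
  then show ?case using reorders.Nil by simp
next
  case (Cons e es)
  have g: "grid_morphism E c l" using l by (simp add: compatible_def)
  have e: "emap l (q, c e) = e" "vmap l q = v" "traverses_from l (q + unit_deg (c e)) (tail E e, es)"
    using Cons(4) by (auto simp: traverses_from_Cons[OF g])
  have "q + word_deg c (snd x) = q + (unit_deg (c e) + word_deg c es)"
    using Cons(3,4) by (simp add: traverses_from_def)
  then have "word_deg c (snd x) = unit_deg (c e) + word_deg c es"
    by (rule add_left_imp_eq)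
  then have "unit_deg (c e) \<le> word_deg c (snd x)"
    by simp
  then obtain e' y where y: "pull (c e) x e' y"
    using pull_ex[of "fst x" "snd x" "c e"] Cons(2) by auto
  note yt = traverses_from_pull[OF l y Cons(3)]
  have y': "pull (c e) x e y"
    using y yt(1) e(1) by simp
  moreover have "reorders y (tail E e, es)"
    using Cons(1)[OF pull_props(1)[OF y Cons(2)] yt(3) e(3)] .
  ultimately have "reorders x (fst x, e # es)"
    by (rule reorders.Cons)
  moreover have "fst x = v"
    using Cons(3) e(2) by (simp add: traverses_from_def)
  ultimately show ?case by simp
qed

text \<open>Translates equality in the k-graph into a relation on which states act by induction. It
  is used in one direction to see that g_a is well defined and in the other to see that it is
  injective.\<close>

lemma path_mor_eq_iff:
  assumes "is_path E x" "is_path E z"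
  shows "path_mor x = path_mor z \<longleftrightarrow> reorders x z"
proof
  assume "path_mor x = path_mor z"
  then show "reorders x z"
    using reorders_if_traverses_from[OF compatible_path_mor[OF assms(1)] assms(1), of 0 "fst z" "snd z"]
      traverses_path_mor[OF assms(1)] traverses_path_mor[OF assms(2)] by simp
next
  assume "reorders x z"
  then have "traverses_from (path_mor x) 0 z"
    using traverses_from_reorders compatible_path_mor traverses_path_mor assms(1) by blast
  then show "path_mor x = path_mor z"
    using path_mor_unique compatible_path_mor assms by blast
qed

lemma path_class_eq:
  assumes "is_path E x"
  shows "path_class E c C x = path_mor x"
  unfolding path_class_def
  using compatible_path_mor[OF assms] traverses_iff_path_mor[OF assms]
  by (intro the_equality) auto

lemma path_mor_in_range_at: "is_path E x \<Longrightarrow> path_mor x \<in> range_at (Lambda E c C) (fst x)"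
  using compatible_path_mor[of x] vmap_path_mor_ends[of "fst x" "snd x"] by (simp add: range_at_def)

lemma range_at_cases:
  assumes "l \<in> range_at (Lambda E c C) v"
  obtains xs where "is_path E (v, xs)" "l = path_mor (v, xs)" "src (Lambda E c C) l = path_end v xs"
proof -
  have "l \<in> arrs (Lambda E c C)" "vmap l 0 = v"
    using assms by (simp_all add: range_at_def)
  then show thesis
    using that by (elim arr_cases) auto
qed

end

section \<open>The groupoid of partial isomorphisms\<close>

text \<open>Closure under products and inverses yields units only at the ends of elements of
  \<open>H\<close>; the second hypothesis provides them at every object.\<close>

lemma (in groupoid) groupoid_subgroupoid:
  assumes H: "subgroupoid G H" and idents: "\<And>v. v \<in> objs G \<Longrightarrow> ident G v \<in> H"
  shows "groupoid (G\<lparr>arrs := H\<rparr>)"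
proof
  have sub: "f \<in> arrs G" if "f \<in> H" for f
    using H that by (auto simp: subgroupoid_def)
  fix g assume g: "g \<in> arrs (G\<lparr>arrs := H\<rparr>)"
  then obtain h where h: "is_inverse G g h"
    using ex_inverse sub by auto
  then have "h \<in> H"
    using H g by (auto simp: subgroupoid_def)
  then show "\<exists>h. is_inverse (G\<lparr>arrs := H\<rparr>) g h"
    using h by (auto simp: is_inverse_def)
qed (use H idents in \<open>auto simp: subgroupoid_def subset_iff rng_in src_in rng_ident src_ident rng_cmp
  src_cmp ident_cmp cmp_ident cmp_assoc\<close>)

text \<open>The closure conditions pass to intersections, and the set of all arrows is one of the
  sets intersected, so the hull consists of arrows.\<close>

lemma subgroupoid_hull:
  assumes "category G" and "S \<subseteq> arrs G"
  shows "subgroupoid G (subgroupoid G hull S)"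
proof -
  interpret category G by fact
  have "subgroupoid G (arrs G)"
    by (auto simp: subgroupoid_def cmp_in is_inverse_def)
  then have "subgroupoid G hull S \<subseteq> arrs G"
    using assms(2) by (intro hull_minimal)
  then show ?thesis
    unfolding subgroupoid_def hull_def by blast
qed

context kgraph
begin

lemma cmp_cancel:
  assumes "l \<in> arrs \<Lambda>" "m \<in> arrs \<Lambda>" "src \<Lambda> l = rng \<Lambda> m"
    and "l' \<in> arrs \<Lambda>" "m' \<in> arrs \<Lambda>" "src \<Lambda> l' = rng \<Lambda> m'"
    and "cmp \<Lambda> l m = cmp \<Lambda> l' m'" "deg \<Lambda> l = deg \<Lambda> l'"
  shows "l = l'" "m = m'"
proof -
  have d: "deg \<Lambda> (cmp \<Lambda> l m) = deg \<Lambda> l + deg \<Lambda> m" "deg \<Lambda> (cmp \<Lambda> l' m') = deg \<Lambda> l' + deg \<Lambda> m'"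
    using deg_cmp[OF assms(1-3)] deg_cmp[OF assms(4-6)] by simp_all
  then have m: "deg \<Lambda> m = deg \<Lambda> m'"
    using assms(7,8) by (metis add_left_imp_eq)
  have "\<exists>\<^sub>\<le>\<^sub>1(a, b). a \<in> arrs \<Lambda> \<and> b \<in> arrs \<Lambda> \<and> src \<Lambda> a = rng \<Lambda> b \<and>
      deg \<Lambda> a = deg \<Lambda> l \<and> deg \<Lambda> b = deg \<Lambda> m \<and> cmp \<Lambda> l m = cmp \<Lambda> a b"
    using unique_factorisation[OF cmp_in[OF assms(1-3)] d(1)] unfolding ex1_iff_ex_Uniq ..
  then have "(l, m) = (l', m')"
    by (rule Uniq_D) (use assms m in simp_all)
  then show "l = l'" "m = m'" by auto
qed

section \<open>Partial isomorphisms, their products and their inverses\<close>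

lemma PIso_simps [simp]:
  "objs (PIso \<Lambda>) = objs \<Lambda>" "arrs (PIso \<Lambda>) = {g. is_piso \<Lambda> g}" "rng (PIso \<Lambda>) = pcod"
  "src (PIso \<Lambda>) = pdom"
  "pdom (ident (PIso \<Lambda>) v) = v" "pcod (ident (PIso \<Lambda>) v) = v"
  "pfun (ident (PIso \<Lambda>) v) = (\<lambda>l\<in>range_at \<Lambda> v. l)"
  "pdom (cmp (PIso \<Lambda>) g h) = pdom h" "pcod (cmp (PIso \<Lambda>) g h) = pcod g"
  "pfun (cmp (PIso \<Lambda>) g h) = compose (range_at \<Lambda> (pdom h)) (pfun g) (pfun h)"
  by (simp_all add: PIso_def)

lemma range_at_iff: "l \<in> range_at \<Lambda> v \<longleftrightarrow> l \<in> arrs \<Lambda> \<and> rng \<Lambda> l = v"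
  by (simp add: range_at_def)

lemma range_deg_at_iff: "l \<in> range_deg_at \<Lambda> v p \<longleftrightarrow> l \<in> range_at \<Lambda> v \<and> deg \<Lambda> l = p"
  by (simp add: range_deg_at_def)

lemma edges_at_iff: "e \<in> edges_at \<Lambda> v \<longleftrightarrow> e \<in> range_at \<Lambda> v \<and> (\<exists>i. deg \<Lambda> e = unit_deg i)"
  by (auto simp: edges_at_def range_deg_at_def)

lemma range_at_cmp:
  assumes "l \<in> range_at \<Lambda> v" "m \<in> range_at \<Lambda> (src \<Lambda> l)"
  shows "cmp \<Lambda> l m \<in> range_at \<Lambda> v" "deg \<Lambda> (cmp \<Lambda> l m) = deg \<Lambda> l + deg \<Lambda> m"
    "src \<Lambda> (cmp \<Lambda> l m) = src \<Lambda> m"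
  using assms by (auto simp: range_at_iff cmp_in rng_cmp src_cmp deg_cmp)

lemma pisoD:
  assumes "is_piso \<Lambda> g" "l \<in> range_at \<Lambda> (pdom g)"
  shows "pfun g l \<in> range_at \<Lambda> (pcod g)" "deg \<Lambda> (pfun g l) = deg \<Lambda> l"
proof -
  have "pfun g l \<in> range_deg_at \<Lambda> (pcod g) (deg \<Lambda> l)"
    using assms by (metis is_piso_def imageI range_deg_at_iff)
  then show "pfun g l \<in> range_at \<Lambda> (pcod g)" "deg \<Lambda> (pfun g l) = deg \<Lambda> l"
    by (auto simp: range_deg_at_iff)
qed

lemma piso_edge: "is_piso \<Lambda> g \<Longrightarrow> e \<in> edges_at \<Lambda> (pdom g) \<Longrightarrow> pfun g e \<in> edges_at \<Lambda> (pcod g)"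
  by (auto simp: edges_at_iff pisoD)

text \<open>The definition only promises some f with the right range. Preservation of degree forces
  f to have the degree of e, hence to be an edge, so that a second partial isomorphism can be
  applied to the product.\<close>

lemma piso_extend:
  assumes g: "is_piso \<Lambda> g" and l: "l \<in> range_at \<Lambda> (pdom g)" and e: "e \<in> edges_at \<Lambda> (src \<Lambda> l)"
  obtains f where "f \<in> edges_at \<Lambda> (src \<Lambda> (pfun g l))" "pfun g (cmp \<Lambda> l e) = cmp \<Lambda> (pfun g l) f"
proof -
  obtain f where f: "f \<in> range_at \<Lambda> (src \<Lambda> (pfun g l))" "pfun g (cmp \<Lambda> l e) = cmp \<Lambda> (pfun g l) f"
    using assms unfolding is_piso_def by blast
  have e': "e \<in> range_at \<Lambda> (src \<Lambda> l)" using e by (simp add: edges_at_iff)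
  have "deg \<Lambda> l + deg \<Lambda> e = deg \<Lambda> (pfun g (cmp \<Lambda> l e))"
    using range_at_cmp[OF l e'] pisoD(2)[OF g] by simp
  also have "\<dots> = deg \<Lambda> l + deg \<Lambda> f"
    using range_at_cmp(2)[OF pisoD(1)[OF g l] f(1)] f(2) pisoD(2)[OF g l] by simp
  finally have "deg \<Lambda> e = deg \<Lambda> f" by (rule add_left_imp_eq)
  then have "f \<in> edges_at \<Lambda> (src \<Lambda> (pfun g l))"
    using f(1) e by (simp add: edges_at_iff)
  with f(2) show thesis by (rule that[rotated])
qed

lemma piso_eqI:
  assumes "is_piso \<Lambda> g" "is_piso \<Lambda> h" "pdom g = pdom h" "pcod g = pcod h"
    and "\<And>l. l \<in> range_at \<Lambda> (pdom g) \<Longrightarrow> pfun g l = pfun h l"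
  shows "g = h"
proof -
  have "pfun g = pfun h"
    using assms by (intro extensionalityI[of _ "range_at \<Lambda> (pdom g)"]) (auto simp: is_piso_def)
  then show ?thesis using assms(3,4) by (cases g; cases h) auto
qed

text \<open>For a bijection, preservation of the degree of each element already gives equality of
  the degree-p parts.\<close>

lemma is_pisoI:
  assumes "pdom g \<in> objs \<Lambda>" "pcod g \<in> objs \<Lambda>" "pfun g \<in> extensional (range_at \<Lambda> (pdom g))"
    and bij: "bij_betw (pfun g) (range_at \<Lambda> (pdom g)) (range_at \<Lambda> (pcod g))"
    and deg: "\<And>l. l \<in> range_at \<Lambda> (pdom g) \<Longrightarrow> deg \<Lambda> (pfun g l) = deg \<Lambda> l"
    and ext: "\<And>l e. l \<in> range_at \<Lambda> (pdom g) \<Longrightarrow> e \<in> edges_at \<Lambda> (src \<Lambda> l) \<Longrightarrow>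
        \<exists>f\<in>range_at \<Lambda> (src \<Lambda> (pfun g l)). pfun g (cmp \<Lambda> l e) = cmp \<Lambda> (pfun g l) f"
  shows "is_piso \<Lambda> g"
proof -
  have "pfun g ` range_deg_at \<Lambda> (pdom g) p = range_deg_at \<Lambda> (pcod g) p" for p
  proof (intro equalityI subsetI)
    fix m assume "m \<in> range_deg_at \<Lambda> (pcod g) p"
    moreover from this obtain l where "l \<in> range_at \<Lambda> (pdom g)" "m = pfun g l"
      using bij by (auto simp: range_deg_at_iff bij_betw_def)
    ultimately show "m \<in> pfun g ` range_deg_at \<Lambda> (pdom g) p"
      using deg by (auto simp: range_deg_at_iff)
  qed (use bij deg in \<open>auto simp: range_deg_at_iff bij_betw_def\<close>)
  then show ?thesis
    unfolding is_piso_def using assms(1-4) ext by blast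
qed

lemma is_piso_ident:
  assumes "v \<in> objs \<Lambda>"
  shows "is_piso \<Lambda> (ident (PIso \<Lambda>) v)"
proof (rule is_pisoI)
  fix l e
  assume "l \<in> range_at \<Lambda> (pdom (ident (PIso \<Lambda>) v))" and e: "e \<in> edges_at \<Lambda> (src \<Lambda> l)"
  then have "l \<in> range_at \<Lambda> v" "e \<in> range_at \<Lambda> (src \<Lambda> l)"
    by (simp_all add: edges_at_iff)
  then show "\<exists>f\<in>range_at \<Lambda> (src \<Lambda> (pfun (ident (PIso \<Lambda>) v) l)).
      pfun (ident (PIso \<Lambda>) v) (cmp \<Lambda> l e) = cmp \<Lambda> (pfun (ident (PIso \<Lambda>) v) l) f"
    using range_at_cmp(1)[of l v e] by auto
qed (use assms in \<open>auto simp: bij_betw_def inj_on_def\<close>)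

lemma is_piso_cmp:
  assumes g: "is_piso \<Lambda> g" and h: "is_piso \<Lambda> h" and gh: "pdom g = pcod h"
  shows "is_piso \<Lambda> (cmp (PIso \<Lambda>) g h)"
proof (rule is_pisoI)
  show "bij_betw (pfun (cmp (PIso \<Lambda>) g h)) (range_at \<Lambda> (pdom (cmp (PIso \<Lambda>) g h)))
      (range_at \<Lambda> (pcod (cmp (PIso \<Lambda>) g h)))"
    using g h gh by (auto simp: is_piso_def intro: bij_betw_compose)
next
  fix l e assume "l \<in> range_at \<Lambda> (pdom (cmp (PIso \<Lambda>) g h))" and e: "e \<in> edges_at \<Lambda> (src \<Lambda> l)"
  then have l: "l \<in> range_at \<Lambda> (pdom h)" by simp
  have le: "cmp \<Lambda> l e \<in> range_at \<Lambda> (pdom h)"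
    using range_at_cmp(1)[OF l] e by (simp add: edges_at_iff)
  obtain f where f: "f \<in> edges_at \<Lambda> (src \<Lambda> (pfun h l))" "pfun h (cmp \<Lambda> l e) = cmp \<Lambda> (pfun h l) f"
    using piso_extend[OF h l e] .
  have hl: "pfun h l \<in> range_at \<Lambda> (pdom g)"
    using pisoD(1)[OF h l] gh by simp
  obtain d where "d \<in> edges_at \<Lambda> (src \<Lambda> (pfun g (pfun h l)))"
    "pfun g (cmp \<Lambda> (pfun h l) f) = cmp \<Lambda> (pfun g (pfun h l)) d"
    using piso_extend[OF g hl f(1)] .
  then show "\<exists>f\<in>range_at \<Lambda> (src \<Lambda> (pfun (cmp (PIso \<Lambda>) g h) l)).
      pfun (cmp (PIso \<Lambda>) g h) (cmp \<Lambda> l e) = cmp \<Lambda> (pfun (cmp (PIso \<Lambda>) g h) l) f"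
    using l le f(2) by (auto simp: compose_eq edges_at_iff)
next
  fix l assume "l \<in> range_at \<Lambda> (pdom (cmp (PIso \<Lambda>) g h))"
  then show "deg \<Lambda> (pfun (cmp (PIso \<Lambda>) g h) l) = deg \<Lambda> l"
    using pisoD[OF h] pisoD(2)[OF g] gh by (simp add: compose_eq)
qed (use g h in \<open>simp_all add: is_piso_def\<close>)

text \<open>The delicate point is that the inverse h respects prefixes. Factor h(l e) as l' f with
  l' of the degree of l. As g respects prefixes, g(l') is a prefix of l e of that degree, so unique
  factorisation gives g(l') = l, that is, l' = h(l).\<close>

lemma ex_inverse_PIso:
  assumes g: "is_piso \<Lambda> g"
  shows "\<exists>h. is_inverse (PIso \<Lambda>) g h"
proof -
  let ?R = "range_at \<Lambda> (pdom g)" and ?S = "range_at \<Lambda> (pcod g)"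
  define h where "h = \<lparr>pdom = pcod g, pcod = pdom g, pfun = restrict (inv_into ?R (pfun g)) ?S\<rparr>"
  have bij: "bij_betw (pfun g) ?R ?S"
    using g by (simp add: is_piso_def)
  have h [simp]: "pdom h = pcod g" "pcod h = pdom g"
    and hg: "\<And>l. l \<in> ?R \<Longrightarrow> pfun h (pfun g l) = l"
    and gh: "\<And>l. l \<in> ?S \<Longrightarrow> pfun g (pfun h l) = l"
    and h_in: "\<And>l. l \<in> ?S \<Longrightarrow> pfun h l \<in> ?R"
    using bij bij_betw_inv_into_left[OF bij] bij_betw_inv_into_right[OF bij]
      bij_betw_apply[OF bij_betw_inv_into[OF bij]] pisoD(1)[OF g]
    by (auto simp: h_def)
  have hp: "is_piso \<Lambda> h"
  proof (rule is_pisoI)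
    show "bij_betw (pfun h) (range_at \<Lambda> (pdom h)) (range_at \<Lambda> (pcod h))"
      using hg gh h_in pisoD(1)[OF g] by (intro bij_betw_byWitness[of _ "pfun g"]) auto
    show "pfun h \<in> extensional (range_at \<Lambda> (pdom h))" by (simp add: h_def)
    fix l assume l: "l \<in> range_at \<Lambda> (pdom h)"
    then show "deg \<Lambda> (pfun h l) = deg \<Lambda> l"
      using pisoD(2)[OF g h_in] gh by simp
    fix e assume e: "e \<in> edges_at \<Lambda> (src \<Lambda> l)"
    have l: "l \<in> ?S" using l by simp
    have e': "e \<in> range_at \<Lambda> (src \<Lambda> l)" using e by (simp add: edges_at_iff)
    note le = range_at_cmp[OF l e']
    define m where "m = pfun h (cmp \<Lambda> l e)"
    have m: "m \<in> ?R" "pfun g m = cmp \<Lambda> l e"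
      using h_in gh le(1) by (auto simp: m_def)
    have "deg \<Lambda> m = deg \<Lambda> l + deg \<Lambda> e"
      using pisoD(2)[OF g m(1)] m(2) le by simp
    then obtain l' f where f: "l' \<in> arrs \<Lambda>" "f \<in> arrs \<Lambda>" "src \<Lambda> l' = rng \<Lambda> f" "deg \<Lambda> l' = deg \<Lambda> l"
      "deg \<Lambda> f = deg \<Lambda> e" "m = cmp \<Lambda> l' f"
      using unique_factorisation[of m "deg \<Lambda> l" "deg \<Lambda> e"] m(1) by (auto simp: range_at_iff)
    have l': "l' \<in> ?R"
      using f m(1) rng_cmp[of l' f] by (simp add: range_at_iff)
    have "f \<in> edges_at \<Lambda> (src \<Lambda> l')"
      using f e by (auto simp: edges_at_iff range_at_iff)
    then obtain d where d: "d \<in> edges_at \<Lambda> (src \<Lambda> (pfun g l'))" "pfun g m = cmp \<Lambda> (pfun g l') d"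
      using piso_extend[OF g l'] f(6) by blast
    have "l = pfun g l'"
      using cmp_cancel(1)[of l e "pfun g l'" d] l e' d m(2) pisoD[OF g l'] f(4)
      by (auto simp: range_at_iff edges_at_iff)
    then have "pfun h l = l'" using hg l' by simp
    then show "\<exists>f\<in>range_at \<Lambda> (src \<Lambda> (pfun h l)). pfun h (cmp \<Lambda> l e) = cmp \<Lambda> (pfun h l) f"
      using f m_def by (auto simp: range_at_iff)
  qed (use g in \<open>auto simp: is_piso_def\<close>)
  have "cmp (PIso \<Lambda>) g h = ident (PIso \<Lambda>) (pcod g)"
    using is_piso_cmp[OF g hp] is_piso_ident g gh
    by (intro piso_eqI) (auto simp: compose_eq is_piso_def)
  moreover have "cmp (PIso \<Lambda>) h g = ident (PIso \<Lambda>) (pdom g)"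
    using is_piso_cmp[OF hp g] is_piso_ident g hg
    by (intro piso_eqI) (auto simp: compose_eq is_piso_def)
  ultimately show ?thesis
    using hp by (intro exI[of _ h]) (simp add: is_inverse_def)
qed

lemma groupoid_PIso: "groupoid (PIso \<Lambda>)"
proof
  fix g h k assume "g \<in> arrs (PIso \<Lambda>)" "h \<in> arrs (PIso \<Lambda>)" "k \<in> arrs (PIso \<Lambda>)"
    "src (PIso \<Lambda>) g = rng (PIso \<Lambda>) h" "src (PIso \<Lambda>) h = rng (PIso \<Lambda>) k"
  then have ghk: "is_piso \<Lambda> g" "is_piso \<Lambda> h" "is_piso \<Lambda> k" "pdom g = pcod h" "pdom h = pcod k"
    by simp_all
  note gh = is_piso_cmp[OF ghk(1,2,4)] and hk = is_piso_cmp[OF ghk(2,3,5)]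
  show "cmp (PIso \<Lambda>) (cmp (PIso \<Lambda>) g h) k = cmp (PIso \<Lambda>) g (cmp (PIso \<Lambda>) h k)"
  proof (rule piso_eqI)
    show "is_piso \<Lambda> (cmp (PIso \<Lambda>) (cmp (PIso \<Lambda>) g h) k)"
      using is_piso_cmp[OF gh ghk(3)] ghk(5) by simp
    show "is_piso \<Lambda> (cmp (PIso \<Lambda>) g (cmp (PIso \<Lambda>) h k))"
      using is_piso_cmp[OF ghk(1) hk] ghk(4) by simp
    fix l assume "l \<in> range_at \<Lambda> (pdom (cmp (PIso \<Lambda>) (cmp (PIso \<Lambda>) g h) k))"
    then show "pfun (cmp (PIso \<Lambda>) (cmp (PIso \<Lambda>) g h) k) l = pfun (cmp (PIso \<Lambda>) g (cmp (PIso \<Lambda>) h k)) l"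
      using pisoD(1)[OF ghk(3)] ghk(5) by (simp add: compose_eq)
  qed simp_all
next
  fix g assume "g \<in> arrs (PIso \<Lambda>)"
  then have g: "is_piso \<Lambda> g" "pdom g \<in> objs \<Lambda>" "pcod g \<in> objs \<Lambda>"
    by (simp_all add: is_piso_def)
  note idents = is_piso_ident[OF g(2)] is_piso_ident[OF g(3)]
  show "rng (PIso \<Lambda>) g \<in> objs (PIso \<Lambda>)" "src (PIso \<Lambda>) g \<in> objs (PIso \<Lambda>)"
    "\<exists>h. is_inverse (PIso \<Lambda>) g h"
    using g ex_inverse_PIso by simp_all
  show "cmp (PIso \<Lambda>) (ident (PIso \<Lambda>) (rng (PIso \<Lambda>) g)) g = g"
    using is_piso_cmp[OF idents(2) g(1)] g pisoD(1)[OF g(1)]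
    by (intro piso_eqI) (simp_all add: compose_eq)
  show "cmp (PIso \<Lambda>) g (ident (PIso \<Lambda>) (src (PIso \<Lambda>) g)) = g"
    using is_piso_cmp[OF g(1) idents(1)] g
    by (intro piso_eqI) (simp_all add: compose_eq)
qed (simp_all add: is_piso_ident is_piso_cmp)

lemma is_inverse_PIsoD:
  assumes "is_inverse (PIso \<Lambda>) g h"
  shows "pdom h = pcod g" "pcod h = pdom g"
    and "l \<in> range_at \<Lambda> (pcod g) \<Longrightarrow> pfun g (pfun h l) = l"
    and "l \<in> range_at \<Lambda> (pdom g) \<Longrightarrow> pfun h (pfun g l) = l"
proof -
  have ids: "cmp (PIso \<Lambda>) g h = ident (PIso \<Lambda>) (pcod g)"
    "cmp (PIso \<Lambda>) h g = ident (PIso \<Lambda>) (pdom g)"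
    using assms by (simp_all add: is_inverse_def)
  show dom: "pdom h = pcod g" "pcod h = pdom g"
    using assms by (simp_all add: is_inverse_def)
  show "pfun g (pfun h l) = l" if "l \<in> range_at \<Lambda> (pcod g)"
    using arg_cong[OF ids(1), of "\<lambda>p. pfun p l"] that dom by (simp add: compose_eq)
  show "pfun h (pfun g l) = l" if "l \<in> range_at \<Lambda> (pdom g)"
    using arg_cong[OF ids(2), of "\<lambda>p. pfun p l"] that dom by (simp add: compose_eq)
qed

lemma self_similar_action_hull:
  assumes pisos: "\<And>g. g \<in> S \<Longrightarrow> is_piso \<Lambda> g"
    and idents: "\<And>v. v \<in> objs \<Lambda> \<Longrightarrow> ident (PIso \<Lambda>) v \<in> S"
    and sections: "\<And>g e. g \<in> S \<Longrightarrow> e \<in> edges_at \<Lambda> (pdom g) \<Longrightarrow>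
      \<exists>h\<in>S. pdom h = src \<Lambda> e \<and> pcod h = src \<Lambda> (pfun g e) \<and>
        (\<forall>l\<in>range_at \<Lambda> (src \<Lambda> e). pfun g (cmp \<Lambda> e l) = cmp \<Lambda> (pfun g e) (pfun h l))"
  shows "self_similar_action \<Lambda> ((PIso \<Lambda>)\<lparr>arrs := subgroupoid (PIso \<Lambda>) hull S\<rparr>) (\<lambda>g. g)"
proof -
  interpret P: groupoid "PIso \<Lambda>" by (rule groupoid_PIso)
  let ?H = "subgroupoid (PIso \<Lambda>) hull S"
  have H: "subgroupoid (PIso \<Lambda>) ?H"
    using subgroupoid_hull[OF P.category_axioms, of S] pisos by auto
  have H_piso: "is_piso \<Lambda> g" if "g \<in> ?H" for g
    using H that by (auto simp: subgroupoid_def)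
  interpret G: groupoid "(PIso \<Lambda>)\<lparr>arrs := ?H\<rparr>"
    by (rule P.groupoid_subgroupoid[OF H]) (simp add: idents hull_inc)
  define sect where "sect g e h \<longleftrightarrow> h \<in> ?H \<and> pdom h = src \<Lambda> e \<and> pcod h = src \<Lambda> (pfun g e) \<and>
    (\<forall>l\<in>range_at \<Lambda> (src \<Lambda> e). pfun g (cmp \<Lambda> e l) = cmp \<Lambda> (pfun g e) (pfun h l))"
    for g h :: "('o, 'm) piso" and e
  \<comment> \<open>Sections of products and inverses of generators need not lie in
    \<open>S\<close>, so only membership in the hull is asked of them.\<close>
  define T where "T = {g \<in> ?H. \<forall>e\<in>edges_at \<Lambda> (pdom g). \<exists>h. sect g e h}"
  have cmp_T: "cmp (PIso \<Lambda>) g h \<in> T" if g: "g \<in> T" and h: "h \<in> T" and gh: "pdom g = pcod h" for g h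
  proof -
    have gH: "g \<in> ?H" "is_piso \<Lambda> g" and hH: "h \<in> ?H" "is_piso \<Lambda> h"
      using g h H_piso by (auto simp: T_def)
    have "\<exists>k. sect (cmp (PIso \<Lambda>) g h) e k" if e: "e \<in> edges_at \<Lambda> (pdom h)" for e
    proof -
      obtain h' where h': "sect h e h'"
        using h e by (auto simp: T_def)
      have he: "pfun h e \<in> edges_at \<Lambda> (pdom g)"
        using piso_edge[OF hH(2) e] gh by simp
      then obtain g' where g': "sect g (pfun h e) g'"
        using g by (auto simp: T_def)
      have e': "e \<in> range_at \<Lambda> (pdom h)" using e by (simp add: edges_at_iff)
      \<comment> \<open>The section of a product: (g h)|_e is g|_(h.e) times h|_e.\<close>
      have "cmp (PIso \<Lambda>) g' h' \<in> ?H"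
        using H g' h' by (auto simp: subgroupoid_def sect_def)
      moreover have "pfun (cmp (PIso \<Lambda>) g h) (cmp \<Lambda> e l) =
          cmp \<Lambda> (pfun (cmp (PIso \<Lambda>) g h) e) (pfun (cmp (PIso \<Lambda>) g' h') l)"
        if l: "l \<in> range_at \<Lambda> (src \<Lambda> e)" for l
      proof -
        have "pfun h' l \<in> range_at \<Lambda> (src \<Lambda> (pfun h e))"
          using pisoD(1)[OF H_piso, of h' l] h' l by (auto simp: sect_def)
        then show ?thesis
          using h' g' l e' range_at_cmp(1)[OF e' l] by (auto simp: sect_def compose_eq)
      qed
      ultimately show ?thesis
        using h' g' e' by (intro exI[of _ "cmp (PIso \<Lambda>) g' h'"]) (auto simp: sect_def compose_eq)
    qed
    moreover have "cmp (PIso \<Lambda>) g h \<in> ?H"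
      using H gH hH gh by (auto simp: subgroupoid_def)
    ultimately show ?thesis by (auto simp: T_def)
  qed
  have inv_T: "h \<in> T" if g: "g \<in> T" and inv: "is_inverse (PIso \<Lambda>) g h" for g h
  proof -
    have gH: "g \<in> ?H" "is_piso \<Lambda> g"
      using g H_piso by (auto simp: T_def)
    have hH: "h \<in> ?H" "is_piso \<Lambda> h"
      using H gH inv by (auto simp: subgroupoid_def is_inverse_def)
    note dom = is_inverse_PIsoD(1,2)[OF inv] and gh = is_inverse_PIsoD(3)[OF inv]
      and hg = is_inverse_PIsoD(4)[OF inv]
    have "\<exists>k. sect h f k" if f: "f \<in> edges_at \<Lambda> (pdom h)" for f
    proof -
      define e where "e = pfun h f"
      have e: "e \<in> edges_at \<Lambda> (pdom g)" "pfun g e = f"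
        using piso_edge[OF hH(2) f] dom gh f by (auto simp: e_def edges_at_iff)
      have e': "e \<in> range_at \<Lambda> (pdom g)" using e by (simp add: edges_at_iff)
      obtain g' where g': "sect g e g'"
        using g e by (auto simp: T_def)
      then have g'H: "is_piso \<Lambda> g'" "pdom g' = src \<Lambda> e" "pcod g' = src \<Lambda> f"
        using H_piso e(2) by (auto simp: sect_def)
      \<comment> \<open>The section of the inverse at f is the inverse of the section of g at the
        edge e that g sends to f.\<close>
      obtain k where k: "is_inverse (PIso \<Lambda>) g' k"
        using ex_inverse_PIso[OF g'H(1)] by blast
      have kH: "k \<in> ?H" "is_piso \<Lambda> k" "pdom k = src \<Lambda> f" "pcod k = src \<Lambda> e"
        using H g' k g'H by (auto simp: subgroupoid_def is_inverse_def sect_def)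
      have "pfun h (cmp \<Lambda> f l) = cmp \<Lambda> e (pfun k l)" if l: "l \<in> range_at \<Lambda> (src \<Lambda> f)" for l
      proof -
        have kl: "pfun k l \<in> range_at \<Lambda> (src \<Lambda> e)"
          using pisoD(1)[OF kH(2)] l kH by simp
        have "pfun g' (pfun k l) = l"
          using is_inverse_PIsoD(3)[OF k] l g'H by simp
        then have "pfun g (cmp \<Lambda> e (pfun k l)) = cmp \<Lambda> f l"
          using g' kl e(2) by (simp add: sect_def)
        then show ?thesis
          using hg[OF range_at_cmp(1)[OF e' kl]] by simp
      qed
      then show ?thesis
        using kH by (intro exI[of _ k]) (simp add: sect_def e_def)
    qed
    then show ?thesis using hH by (simp add: T_def)
  qed
  have "subgroupoid (PIso \<Lambda>) T"
  proof -
    have "T \<subseteq> arrs (PIso \<Lambda>)" using H_piso by (auto simp: T_def)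
    then show ?thesis using cmp_T inv_T by (simp add: subgroupoid_def)
  qed
  moreover have "S \<subseteq> T"
  proof
    fix g assume g: "g \<in> S"
    have "\<exists>h. sect g e h" if "e \<in> edges_at \<Lambda> (pdom g)" for e
      using sections[OF g that] unfolding sect_def by (blast intro: hull_inc)
    then show "g \<in> T"
      using g by (simp add: T_def hull_inc)
  qed
  ultimately have "?H \<subseteq> T" by (intro hull_minimal)
  then have sect: "\<exists>h. sect g e h" if "g \<in> ?H" "e \<in> edges_at \<Lambda> (pdom g)" for g e
    using that by (auto simp: T_def)
  show ?thesis
  proof
    fix g e
    assume "g \<in> arrs ((PIso \<Lambda>)\<lparr>arrs := ?H\<rparr>)" "e \<in> edges_at \<Lambda> (src ((PIso \<Lambda>)\<lparr>arrs := ?H\<rparr>) g)"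
    then show "\<exists>h\<in>arrs ((PIso \<Lambda>)\<lparr>arrs := ?H\<rparr>). src ((PIso \<Lambda>)\<lparr>arrs := ?H\<rparr>) h = src \<Lambda> e \<and>
      rng ((PIso \<Lambda>)\<lparr>arrs := ?H\<rparr>) h = src \<Lambda> (pfun g e) \<and>
      (\<forall>l\<in>range_at \<Lambda> (src \<Lambda> e). pfun g (cmp \<Lambda> e l) = cmp \<Lambda> (pfun g e) (pfun h l))"
      using sect[of g e] by (auto simp: sect_def)
  qed (auto simp: H_piso)
qed

end

section \<open>Automata\<close>

locale square_automaton = square_collection E c C + EC_automaton E c C A
  for E :: "('v,'e) pre_digraph" and c :: "'e \<Rightarrow> 'k::finite" and C and A
begin

section \<open>The action of states on paths\<close>

lemma head_act: "a \<in> states A \<Longrightarrow> e \<in> arcs E \<Longrightarrow> asrc A a = head E e \<Longrightarrow> head E (act A a e) = arng A a"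
  using bij_betw_apply[OF A1, of a e] by simp

lemma act_path_simps [simp]: "act_path A a (v, xs) = (arng A a, act_word A a xs)"
  by (simp add: act_path_def)

lemma is_path_act:
  assumes "a \<in> states A" "is_path E (asrc A a, xs)"
  shows "is_path E (arng A a, act_word A a xs)" "word_deg c (act_word A a xs) = word_deg c xs"
proof -
  have "is_path E (arng A a, act_word A a xs) \<and> word_deg c (act_word A a xs) = word_deg c xs"
    using assms
  proof (induction xs arbitrary: a)
    case Nil
    then show ?case by (simp add: arng_in)
  next
    case (Cons x xs)
    then have x: "a \<in> states A" "x \<in> arcs E" "asrc A a = head E x" "is_path E (tail E x, xs)"
      by auto
    then show ?case
      using Cons(1)[of "sect A a x"] sect_in[OF x(1-3)] A3[OF x(1-3)]
      by (simp add: act_in head_act tail_act A2)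
  qed
  then show "is_path E (arng A a, act_word A a xs)" "word_deg c (act_word A a xs) = word_deg c xs"
    by auto
qed

text \<open>(A2) keeps the colour test unchanged and (A5) carries each crossed square to a square.
  (A6) says that both ways around that square leave the automaton in the same state, so the rest of
  the path is moved consistently.\<close>

lemma pull_act:
  assumes "pull i x e y" "is_path E x" "a \<in> states A" "asrc A a = fst x"
  shows "pull i (act_path A a x) (act A a e) (act_path A (sect A a e) y)"
  using assms
proof (induction arbitrary: a rule: pull.induct)
  case (here x xs)
  then show ?case
    using pull.here[of "act A a x" "act_word A (sect A a x) xs"]
    by (simp add: A2 head_act tail_act)
next
  case (there x i xs e u ys e' x')
  then have x: "a \<in> states A" "x \<in> arcs E" "asrc A a = head E x" "is_path E (tail E x, xs)"
    by auto
  note xD = sect_in[OF x(1-3)] A3[OF x(1-3)]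
  note sqD = squareD[OF there(3)]
  have e': "asrc A a = head E e'" using x sqD by simp
  have e: "asrc A (sect A a x) = head E e" using xD sqD by simp
  have IH: "pull i (tail E (act A a x), act_word A (sect A a x) xs) (act A (sect A a x) e)
      (act_path A (sect A (sect A a x) e) (u, ys))"
    using there(4)[OF x(4)] xD tail_act[OF x(1-3)] by simp
  have sq: "square_rel C (act A a x) (act A (sect A a x) e) (act A a e') (act A (sect A a e') x')"
    using A5[OF x(1) there(3)] x(3) by simp
  have "c (act A a x) \<noteq> i"
    using A2[OF x(1-3)] there(1) by simp
  from pull.there[OF this IH[unfolded act_path_simps] sq]
  have "pull i (head E (act A a x), act A a x # act_word A (sect A a x) xs) (act A a e')
      (tail E (act A a e'), act A (sect A a e') x' # act_word A (sect A (sect A a x) e) ys)" .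
  moreover have "sect A (sect A a x) e = sect A (sect A a e') x'"
    using A6[OF x(1) there(3)] x(3) by simp
  ultimately show ?case
    using head_act[OF x(1-3)] tail_act[OF x(1) sqD(3) e'] by simp
qed

lemma reorders_act:
  assumes "reorders x z" "is_path E x" "a \<in> states A" "asrc A a = fst x"
  shows "reorders (act_path A a x) (act_path A a z)"
  using assms
proof (induction arbitrary: a rule: reorders.induct)
  case (Nil v)
  then show ?case using reorders.Nil by simp
next
  case (Cons e x y u es)
  note p = pull_props[OF Cons(1,4)]
  have e: "a \<in> states A" "e \<in> arcs E" "asrc A a = head E e"
    using Cons p by auto
  have "pull (c (act A a e)) (act_path A a x) (act A a e) (act_path A (sect A a e) y)"
    using pull_act[OF Cons(1,4-)] A2[OF e] by simp
  moreover have "reorders (act_path A (sect A a e) y) (arng A (sect A a e), act_word A (sect A a e) es)"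
    using Cons(3)[OF p(1) sect_in[OF e]] A3[OF e] p by simp
  ultimately have "reorders (act_path A a x)
      (fst (act_path A a x), act A a e # act_word A (sect A a e) es)"
    by (rule reorders.Cons)
  then show ?case by (simp add: act_path_def)
qed

text \<open>This makes g_a injective. By uniqueness, a pull from the image path is the image of a
  pull from \<open>xs\<close>; injectivity in (A1) then identifies the pulled edge with e, and one
  state acts on both remaining paths. The free u lets the induction hypothesis accept the vertex
  produced by the rule \<open>Cons\<close>.\<close>

lemma reorders_act_imp:
  assumes "reorders (arng A a, act_word A a xs) (u, act_word A a zs)" "a \<in> states A"
    and "is_path E (asrc A a, xs)" "is_path E (asrc A a, zs)"
  shows "reorders (asrc A a, xs) (asrc A a, zs)"
  using assms
proof (induction zs arbitrary: a u xs)
  case Nil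
  from Nil(1) have "xs = []"
    by (cases rule: reorders.cases) (cases xs; simp)+
  then show ?case using reorders.Nil by simp
next
  case (Cons e es)
  then have e: "a \<in> states A" "e \<in> arcs E" "asrc A a = head E e" and es: "is_path E (tail E e, es)"
    by auto
  note xs = \<open>is_path E (asrc A a, xs)\<close>
  note axs = is_path_act[OF e(1) xs]
  obtain y w where y: "pull (c e) (arng A a, act_word A a xs) (act A a e) y"
    and w: "reorders y (w, act_word A (sect A a e) es)"
    using Cons(2) by (cases rule: reorders.cases) (auto simp: A2[OF e])
  have "unit_deg (c e) \<le> word_deg c xs"
    using pull_props(6)[OF y axs(1)] axs(2) by simp
  then obtain f z where z: "pull (c e) (asrc A a, xs) f z"
    using pull_ex[OF xs] by blast
  note zp = pull_props[OF z xs]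
  have "pull (c e) (arng A a, act_word A a xs) (act A a f) (act_path A (sect A a f) z)"
    using pull_act[OF z xs e(1)] by simp
  from pull_unique[OF y this]
  have f: "act A a f = act A a e" and y': "act_path A (sect A a f) z = y" by auto
  have [simp]: "f = e"
    using bij_betw_imp_inj_on[OF A1[OF e(1)]] f zp e by (auto dest: inj_onD)
  have z': "z = (asrc A (sect A a e), snd z)"
    using zp(4) A3[OF e] by (cases z) simp
  have "reorders (asrc A (sect A a e), snd z) (asrc A (sect A a e), es)"
  proof (rule Cons(1))
    show "reorders (arng A (sect A a e), act_word A (sect A a e) (snd z)) (w, act_word A (sect A a e) es)"
      using w y' by (simp add: act_path_def)
    show "is_path E (asrc A (sect A a e), snd z)" using zp(1) z' by simp
    show "is_path E (asrc A (sect A a e), es)" using es A3[OF e] by simp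
  qed (rule sect_in[OF e])
  then have "reorders (asrc A a, xs) (fst (asrc A a, xs), e # es)"
    using reorders.Cons[of e "(asrc A a, xs)" z] z z' by simp
  then show ?case by simp
qed

text \<open>(A1) solves for the first edge, and the remaining equation is one for the state reached
  by it.\<close>

lemma act_word_surj:
  assumes "a \<in> states A" "is_path E (arng A a, zs)"
  shows "\<exists>xs. is_path E (asrc A a, xs) \<and> act_word A a xs = zs"
  using assms
proof (induction zs arbitrary: a)
  case Nil
  then show ?case by (intro exI[of _ "[]"]) (simp add: asrc_in)
next
  case (Cons z zs)
  then have "z \<in> {e \<in> arcs E. head E e = arng A a}" by auto
  then obtain e where e: "e \<in> arcs E" "asrc A a = head E e" "act A a e = z"
    unfolding bij_betw_imp_surj_on[OF A1[OF Cons(2)], symmetric] by auto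
  have "is_path E (arng A (sect A a e), zs)"
    using Cons(3) tail_act[OF Cons(2) e(1,2)] e(3) by simp
  then obtain xs where "is_path E (asrc A (sect A a e), xs)" "act_word A (sect A a e) xs = zs"
    using Cons(1) sect_in[OF Cons(2) e(1,2)] by blast
  then show ?case
    using e A3[OF Cons(2) e(1,2)] by (intro exI[of _ "e # xs"]) simp
qed

section \<open>The partial isomorphism of a state\<close>

abbreviation "g \<equiv> state_piso E c C A"

lemma state_piso_ends [simp]: "pdom (g a) = asrc A a" "pcod (g a) = arng A a"
  by (simp_all add: state_piso_def)

text \<open>Any other path traversing the same morphism is a reordering of this one. Reorderings
  survive the action, so all candidates in the \<open>THE\<close> coincide.\<close>

lemma state_piso_path_mor:
  assumes a: "a \<in> states A" and x: "is_path E (asrc A a, xs)"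
  shows "pfun (g a) (path_mor (asrc A a, xs)) = path_mor (arng A a, act_word A a xs)"
proof -
  let ?x = "(asrc A a, xs)" and ?ax = "(arng A a, act_word A a xs)"
  have "(THE n. \<exists>y. is_path E y \<and> traverses c y (path_mor ?x) \<and>
      n = path_class E c C (act_path A a y)) = path_mor ?ax"
  proof (rule the_equality)
    show "\<exists>y. is_path E y \<and> traverses c y (path_mor ?x) \<and>
        path_mor ?ax = path_class E c C (act_path A a y)"
      using x path_class_eq[OF is_path_act(1)[OF a x]] traverses_iff_path_mor[OF x] compatible_path_mor[OF x]
      by (intro exI[of _ ?x]) simp
    fix n assume "\<exists>y. is_path E y \<and> traverses c y (path_mor ?x) \<and> n = path_class E c C (act_path A a y)"
    then obtain y where y: "is_path E y" "traverses c y (path_mor ?x)"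
      and n: "n = path_class E c C (act_path A a y)" by blast
    have "path_mor ?x = path_mor y"
      using traverses_iff_path_mor[OF y(1) compatible_path_mor[OF x]] y(2) by simp
    then have r: "reorders ?x y"
      using path_mor_eq_iff[OF x y(1)] by simp
    then have "y = (asrc A a, snd y)"
      using reorders_fst by (cases y) fastforce
    then have ay: "is_path E (act_path A a y)"
      using is_path_act(1)[OF a] y(1) act_path_simps by metis
    have "reorders ?ax (act_path A a y)"
      using reorders_act[OF r x a] by simp
    then show "n = path_mor ?ax"
      using path_mor_eq_iff[OF is_path_act(1)[OF a x] ay] n path_class_eq[OF ay] by simp
  qed
  then show ?thesis
    using path_mor_in_range_at[OF x] by (simp add: state_piso_def)
qed

text \<open>The state \<open>foldl (sect A) a xs\<close> is a|_x for the path x with edges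
  \<open>xs\<close>.\<close>

lemma act_word_append:
  "act_word A a (xs @ ys) = act_word A a xs @ act_word A (foldl (sect A) a xs) ys"
  by (induction xs arbitrary: a) auto

lemma foldl_sect:
  assumes "a \<in> states A" "is_path E (asrc A a, xs)"
  shows "foldl (sect A) a xs \<in> states A" "asrc A (foldl (sect A) a xs) = path_end (asrc A a) xs"
    "arng A (foldl (sect A) a xs) = path_end (arng A a) (act_word A a xs)"
proof -
  have "foldl (sect A) a xs \<in> states A \<and> asrc A (foldl (sect A) a xs) = path_end (asrc A a) xs \<and>
    arng A (foldl (sect A) a xs) = path_end (arng A a) (act_word A a xs)"
    using assms
  proof (induction xs arbitrary: a)
    case (Cons x xs)
    then have x: "a \<in> states A" "x \<in> arcs E" "asrc A a = head E x" "is_path E (tail E x, xs)"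
      by auto
    show ?case
      using Cons(1)[OF sect_in[OF x(1-3)]] x(4) A3[OF x(1-3)] tail_act[OF x(1-3)] by simp
  qed simp
  then show "foldl (sect A) a xs \<in> states A" "asrc A (foldl (sect A) a xs) = path_end (asrc A a) xs"
    "arng A (foldl (sect A) a xs) = path_end (arng A a) (act_word A a xs)" by auto
qed

text \<open>The state b is a|_x for one path x chosen for l, before m is given, so a single b serves
  all m. With l arbitrary this gives the prefix condition on g_a; with l an edge it gives
  self-similarity.\<close>

lemma state_piso_cmp:
  assumes a: "a \<in> states A" and l: "l \<in> range_at (Lambda E c C) (asrc A a)"
  shows "\<exists>b\<in>states A. asrc A b = src (Lambda E c C) l \<and> arng A b = src (Lambda E c C) (pfun (g a) l) \<and>
    (\<forall>m\<in>range_at (Lambda E c C) (src (Lambda E c C) l).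
      pfun (g b) m \<in> range_at (Lambda E c C) (arng A b) \<and>
      pfun (g a) (cmp (Lambda E c C) l m) = cmp (Lambda E c C) (pfun (g a) l) (pfun (g b) m))"
proof -
  obtain xs where xs: "is_path E (asrc A a, xs)" "l = path_mor (asrc A a, xs)"
    "src (Lambda E c C) l = path_end (asrc A a) xs"
    using range_at_cases[OF l] .
  define b where "b = foldl (sect A) a xs"
  note b = foldl_sect[OF a xs(1), folded b_def]
  note axs = is_path_act(1)[OF a xs(1)]
  have gl: "pfun (g a) l = path_mor (arng A a, act_word A a xs)"
    using state_piso_path_mor[OF a xs(1)] xs(2) by simp
  have src_gl: "src (Lambda E c C) (pfun (g a) l) = arng A b"
    using vmap_path_mor_ends(2)[OF axs] b(3) gl by simp
  have "pfun (g b) m \<in> range_at (Lambda E c C) (arng A b) \<and>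
      pfun (g a) (cmp (Lambda E c C) l m) = cmp (Lambda E c C) (pfun (g a) l) (pfun (g b) m)"
    if m: "m \<in> range_at (Lambda E c C) (path_end (asrc A a) xs)" for m
  proof -
    obtain ys where ys: "is_path E (path_end (asrc A a) xs, ys)" "m = path_mor (path_end (asrc A a) xs, ys)"
      using range_at_cases[OF m] .
    have p: "is_path E (asrc A a, xs @ ys)"
      using xs ys by (simp add: is_path_append)
    have ys': "is_path E (asrc A b, ys)" using ys b by simp
    have gm: "pfun (g b) m = path_mor (arng A b, act_word A b ys)"
      using state_piso_path_mor[OF b(1) ys'] ys(2) b(2) by simp
    have ap: "is_path E (arng A a, act_word A a xs @ act_word A b ys)"
      using is_path_act(1)[OF a p] by (simp add: act_word_append b_def)
    have "cmp (Lambda E c C) l m = path_mor (asrc A a, xs @ ys)"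
      using cmp_path_mor[OF p] xs(2) ys(2) by simp
    then have "pfun (g a) (cmp (Lambda E c C) l m) = path_mor (arng A a, act_word A a xs @ act_word A b ys)"
      using state_piso_path_mor[OF a p] by (simp add: act_word_append b_def)
    also have "\<dots> = cmp (Lambda E c C) (pfun (g a) l) (pfun (g b) m)"
      using cmp_path_mor[OF ap] gl gm b(3) by simp
    finally show ?thesis
      using path_mor_in_range_at[OF is_path_act(1)[OF b(1) ys']] gm by simp
  qed
  then show ?thesis
    using b src_gl xs(3) by (intro bexI[of _ b]) simp_all
qed

lemma is_piso_state_piso:
  assumes a: "a \<in> states A"
  shows "is_piso (Lambda E c C) (g a)"
proof (rule kgraph.is_pisoI[OF kgraph_Lambda])
  show "pdom (g a) \<in> objs (Lambda E c C)" "pcod (g a) \<in> objs (Lambda E c C)"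
    using asrc_in[OF a] arng_in[OF a] by simp_all
  show "pfun (g a) \<in> extensional (range_at (Lambda E c C) (pdom (g a)))"
    by (simp add: state_piso_def)
  show "bij_betw (pfun (g a)) (range_at (Lambda E c C) (pdom (g a))) (range_at (Lambda E c C) (pcod (g a)))"
    unfolding state_piso_ends
  proof (intro bij_betw_imageI inj_onI equalityI subsetI)
    fix l m assume l: "l \<in> range_at (Lambda E c C) (asrc A a)" and m: "m \<in> range_at (Lambda E c C) (asrc A a)"
      and eq: "pfun (g a) l = pfun (g a) m"
    obtain xs where xs: "is_path E (asrc A a, xs)" "l = path_mor (asrc A a, xs)"
      using range_at_cases[OF l] .
    obtain ys where ys: "is_path E (asrc A a, ys)" "m = path_mor (asrc A a, ys)"
      using range_at_cases[OF m] .
    have "reorders (arng A a, act_word A a xs) (arng A a, act_word A a ys)"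
      using eq state_piso_path_mor[OF a] xs ys path_mor_eq_iff is_path_act(1)[OF a] by simp
    then have "reorders (asrc A a, xs) (asrc A a, ys)"
      using reorders_act_imp a xs(1) ys(1) by blast
    then show "l = m"
      using path_mor_eq_iff xs ys by simp
  next
    fix n assume "n \<in> pfun (g a) ` range_at (Lambda E c C) (asrc A a)"
    then obtain l where l: "l \<in> range_at (Lambda E c C) (asrc A a)" "n = pfun (g a) l" by blast
    obtain xs where xs: "is_path E (asrc A a, xs)" "l = path_mor (asrc A a, xs)"
      using range_at_cases[OF l(1)] .
    then show "n \<in> range_at (Lambda E c C) (arng A a)"
      using path_mor_in_range_at[OF is_path_act(1)[OF a xs(1)]] state_piso_path_mor[OF a xs(1)] l(2) by simp
  next
    fix n assume n: "n \<in> range_at (Lambda E c C) (arng A a)"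
    obtain zs where zs: "is_path E (arng A a, zs)" "n = path_mor (arng A a, zs)"
      using range_at_cases[OF n] .
    obtain xs where xs: "is_path E (asrc A a, xs)" "act_word A a xs = zs"
      using act_word_surj[OF a zs(1)] by blast
    then show "n \<in> pfun (g a) ` range_at (Lambda E c C) (asrc A a)"
      using path_mor_in_range_at[OF xs(1)] state_piso_path_mor[OF a xs(1)] zs(2)
      by (intro image_eqI[of _ _ "path_mor (asrc A a, xs)"]) simp_all
  qed
next
  fix l assume "l \<in> range_at (Lambda E c C) (pdom (g a))"
  then have "l \<in> range_at (Lambda E c C) (asrc A a)" by simp
  then obtain xs where xs: "is_path E (asrc A a, xs)" "l = path_mor (asrc A a, xs)"
    by (rule range_at_cases)
  then show "deg (Lambda E c C) (pfun (g a) l) = deg (Lambda E c C) l"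
    using state_piso_path_mor[OF a xs(1)] is_path_act(2)[OF a xs(1)] by simp
next
  fix l e assume l: "l \<in> range_at (Lambda E c C) (pdom (g a))"
    and e: "e \<in> edges_at (Lambda E c C) (src (Lambda E c C) l)"
  have l: "l \<in> range_at (Lambda E c C) (asrc A a)" using l by simp
  have e: "e \<in> range_at (Lambda E c C) (src (Lambda E c C) l)"
    using e by (auto simp: edges_at_def range_deg_at_def)
  show "\<exists>f\<in>range_at (Lambda E c C) (src (Lambda E c C) (pfun (g a) l)).
      pfun (g a) (cmp (Lambda E c C) l e) = cmp (Lambda E c C) (pfun (g a) l) f"
    using state_piso_cmp[OF a l] e by metis
qed

text \<open>By (A4) a vertex fixes every edge it acts on and passes to the source of that edge,
  which is again a vertex. All units thus lie among the generators.\<close>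

lemma state_piso_vert:
  assumes v: "v \<in> verts E"
  shows "g v = ident (PIso (Lambda E c C)) v"
proof -
  interpret K: kgraph "Lambda E c C" by (rule kgraph_Lambda)
  have vA: "v \<in> states A" using verts_subset v by blast
  have v': "asrc A v = v" "arng A v = v" using asrc_vert arng_vert v by auto
  have act: "act_word A w xs = xs" if "is_path E (w, xs)" for w xs
    using that by (induction xs arbitrary: w) (auto simp: A4)
  show ?thesis
  proof (rule K.piso_eqI)
    show "is_piso (Lambda E c C) (g v)" using is_piso_state_piso[OF vA] .
    show "is_piso (Lambda E c C) (ident (PIso (Lambda E c C)) v)"
      using K.is_piso_ident v by simp
    fix l assume "l \<in> range_at (Lambda E c C) (pdom (g v))"
    then have l: "l \<in> range_at (Lambda E c C) v" by (simp add: v')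
    obtain xs where xs: "is_path E (v, xs)" "l = path_mor (v, xs)"
      using range_at_cases[OF l] .
    show "pfun (g v) l = pfun (ident (PIso (Lambda E c C)) v) l"
      using state_piso_path_mor[OF vA, of xs] xs act[OF xs(1)] l v' by simp
  qed (simp_all add: v')
qed

theorem self_similar_action_automaton_groupoid:
  "self_similar_action (Lambda E c C) (automaton_groupoid E c C A) (\<lambda>g. g)"
  unfolding automaton_groupoid_def
proof (rule kgraph.self_similar_action_hull[OF kgraph_Lambda])
  fix h assume "h \<in> g ` states A"
  then show "is_piso (Lambda E c C) h" using is_piso_state_piso by blast
next
  fix v assume "v \<in> objs (Lambda E c C)"
  then have "v \<in> verts E" by simp
  then show "ident (PIso (Lambda E c C)) v \<in> g ` states A"
    using state_piso_vert verts_subset by (metis imageI subsetD)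
next
  fix h e assume "h \<in> g ` states A" and e: "e \<in> edges_at (Lambda E c C) (pdom h)"
  then obtain a where a: "a \<in> states A" "h = g a" by blast
  have "e \<in> range_at (Lambda E c C) (asrc A a)"
    using e a(2) by (auto simp: edges_at_def range_deg_at_def)
  from state_piso_cmp[OF a(1) this]
  show "\<exists>k\<in>g ` states A. pdom k = src (Lambda E c C) e \<and> pcod k = src (Lambda E c C) (pfun h e) \<and>
      (\<forall>l\<in>range_at (Lambda E c C) (src (Lambda E c C) e).
        pfun h (cmp (Lambda E c C) e l) = cmp (Lambda E c C) (pfun h e) (pfun k l))"
    unfolding a(2) by (elim bexE) (rule bexI[OF _ imageI], auto)
qed

end

theorem theorem4p8:
  fixes E :: "('v,'e) pre_digraph" and c :: "'e \<Rightarrow> 'k::finite"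
    and C :: "('v,'e,'k) gmor set" and A :: "('v,'e) automaton"
  assumes "wf_digraph E"
    and "complete_collection E c C"
    and "associative_collection E c C"
    and "EC_automaton E c C A"
  shows "self_similar_action (Lambda E c C) (automaton_groupoid E c C A) (\<lambda>g. g)"
proof -
  interpret wf_digraph E by fact
  interpret EC_automaton E c C A by fact
  interpret square_automaton E c C A
    using assms(2,3) by unfold_locales
  show ?thesis by (rule self_similar_action_automaton_groupoid)
qed

end
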